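(* Let $a_1,a_2,a_3,b_1,b_2\in\mathbb{R}$ with $(a_1,a_2,a_3)\neq(0,0,0)$ and consider the system on the unit sphere $\mathbb{S}^2\subset\mathbb{R}^3$ $$\begin{cases} z_1'=z_3\left(-z_2z_3+b_1z_1^2z_3^2+b_2z_1z_2z_3^2+a_1z_1^4+a_2z_1^3z_2+a_3z_1^2z_2^2\right),\\ z_2'=z_3\left(z_1z_3+b_1z_1z_2z_3^2+b_2z_2^2z_3^2+a_1z_1^3z_2+a_2z_1^2z_2^2+a_3z_1z_2^3\right),\\ z_3'=(z_3^2-1)\left(b_1z_1z_3^2+b_2z_2z_3^2+a_1z_1^3+a_2z_1^2z_2+a_3z_1z_2^2\right). \end{cases}$$ If the system has six cusps on the equator $\{z_3=0\}$ and there are no homoclinic nor heteroclinic connections, then it has a periodic solution on the sphere which is symmetric with respect to the origin (its orbit is invariant under $z\mapsto-z$) and whose intersection with the equator consists of two or six regular points (forming antipodal pairs).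
   Context: A cusp is a critical point having a neighbourhood consisting of exactly two hyperbolic sectors (with one orbit tending to the point and one orbit leaving it as separatrices). A regular point is a point at which the vector field does not vanish. A homoclinic (respectively heteroclinic) connection is a nonconstant orbit whose $\alpha$- and $\omega$-limits are the same critical point (respectively two different critical points) on the equator. A periodic solution is a nonconstant periodic solution. *)

theory Defs
  imports "HOL-Analysis.Analysis"
begin

abbreviation S2 :: "(real^3) set" where
  "S2 \<equiv> sphere 0 1"

definition equator :: "(real^3) set" where
  "equator = {z \<in> S2. z $ 3 = 0}"

definition vf :: "real \<Rightarrow> real \<Rightarrow> real \<Rightarrow> real \<Rightarrow> real \<Rightarrow> real^3 \<Rightarrow> real^3" where
  "vf a1 a2 a3 b1 b2 z =
    (let z1 = z $ 1; z2 = z $ 2; z3 = z $ 3 in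
     vector
      [z3 * (- z2 * z3 + b1 * z1^2 * z3^2 + b2 * z1 * z2 * z3^2
             + a1 * z1^4 + a2 * z1^3 * z2 + a3 * z1^2 * z2^2),
       z3 * (z1 * z3 + b1 * z1 * z2 * z3^2 + b2 * z2^2 * z3^2
             + a1 * z1^3 * z2 + a2 * z1^2 * z2^2 + a3 * z1 * z2^3),
       (z3^2 - 1) * (b1 * z1 * z3^2 + b2 * z2 * z3^2
             + a1 * z1^3 + a2 * z1^2 * z2 + a3 * z1 * z2^2)])"

text \<open>
  The field is tangent to the sphere, which is compact, so every maximal solution on the
  sphere is defined for all times; orbits are the ranges of such solutions.
\<close>
definition solution :: "(real^3 \<Rightarrow> real^3) \<Rightarrow> (real \<Rightarrow> real^3) \<Rightarrow> bool" where
  "solution F x \<longleftrightarrow> (\<forall>t. x t \<in> S2 \<and> (x has_vector_derivative F (x t)) (at t))"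

definition nonconstant :: "(real \<Rightarrow> real^3) \<Rightarrow> bool" where
  "nonconstant x \<longleftrightarrow> (\<exists>s t. x s \<noteq> x t)"

definition critical_point :: "(real^3 \<Rightarrow> real^3) \<Rightarrow> real^3 \<Rightarrow> bool" where
  "critical_point F p \<longleftrightarrow> p \<in> S2 \<and> F p = 0"

definition regular_point :: "(real^3 \<Rightarrow> real^3) \<Rightarrow> real^3 \<Rightarrow> bool" where
  "regular_point F p \<longleftrightarrow> p \<in> S2 \<and> F p \<noteq> 0"

definition omega_limit :: "(real \<Rightarrow> real^3) \<Rightarrow> (real^3) set" where
  "omega_limit x =
    {p. \<exists>s :: nat \<Rightarrow> real. filterlim s at_top sequentially \<and> (\<lambda>n. x (s n)) \<longlonglongrightarrow> p}"

definition alpha_limit :: "(real \<Rightarrow> real^3) \<Rightarrow> (real^3) set" where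
  "alpha_limit x =
    {p. \<exists>s :: nat \<Rightarrow> real. filterlim s at_bot sequentially \<and> (\<lambda>n. x (s n)) \<longlonglongrightarrow> p}"

definition homoclinic_connection :: "(real^3 \<Rightarrow> real^3) \<Rightarrow> (real \<Rightarrow> real^3) \<Rightarrow> bool" where
  "homoclinic_connection F x \<longleftrightarrow>
    solution F x \<and> nonconstant x \<and>
    (\<exists>p \<in> equator. critical_point F p \<and> alpha_limit x = {p} \<and> omega_limit x = {p})"

definition heteroclinic_connection :: "(real^3 \<Rightarrow> real^3) \<Rightarrow> (real \<Rightarrow> real^3) \<Rightarrow> bool" where
  "heteroclinic_connection F x \<longleftrightarrow>
    solution F x \<and> nonconstant x \<and>
    (\<exists>p \<in> equator. \<exists>q \<in> equator. critical_point F p \<and> critical_point F q \<and> p \<noteq> q \<and>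
       alpha_limit x = {p} \<and> omega_limit x = {q})"

definition periodic_solution :: "(real^3 \<Rightarrow> real^3) \<Rightarrow> (real \<Rightarrow> real^3) \<Rightarrow> bool" where
  "periodic_solution F x \<longleftrightarrow>
    solution F x \<and> nonconstant x \<and> (\<exists>T>0. \<forall>t. x (t + T) = x t)"

text \<open>
  A hyperbolic sector is a region topologically equivalent to a quadrant of the linear saddle
  \<open>u' = u\<close>, \<open>v' = -v\<close>, cut off to the unit square: a homeomorphism \<open>h\<close> takes each
  saddle orbit in the square to an arc of an orbit of \<open>F\<close>, with the same orientation but possibly
  another parametrization \<open>\<tau>\<close>.  The half-axis \<open>u = 0\<close> becomes the separatrix tending to
  \<open>p\<close>, and the half-axis \<open>v = 0\<close> the one leaving \<open>p\<close>.
\<close>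
definition saddle_flow :: "real \<Rightarrow> real \<times> real \<Rightarrow> real \<times> real" where
  "saddle_flow t q = (exp t * fst q, exp (- t) * snd q)"

definition unit_square :: "(real \<times> real) set" where
  "unit_square = {0..1} \<times> {0..1}"

definition hyperbolic_sector ::
  "(real^3 \<Rightarrow> real^3) \<Rightarrow> real^3 \<Rightarrow> (real^3) set \<Rightarrow> (real \<times> real \<Rightarrow> real^3) \<Rightarrow> bool" where
  "hyperbolic_sector F p S h \<longleftrightarrow>
    (\<exists>g. homeomorphism unit_square S h g) \<and> h (0, 0) = p \<and>
    (\<forall>q \<in> unit_square - {(0, 0)}. \<exists>x \<tau>. solution F x \<and>
       (let I = {t. saddle_flow t q \<in> unit_square} in
          continuous_on I \<tau> \<and> strict_mono_on I \<tau> \<and>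
          (\<forall>t \<in> I. h (saddle_flow t q) = x (\<tau> t))))"

text \<open>
  The two sectors fill a neighbourhood of \<open>p\<close> in the sphere and meet exactly in
  \<open>p\<close> and the two separatrices, the one tending to \<open>p\<close> and the one leaving it, which
  they share.
\<close>
definition cusp :: "(real^3 \<Rightarrow> real^3) \<Rightarrow> real^3 \<Rightarrow> bool" where
  "cusp F p \<longleftrightarrow> critical_point F p \<and>
    (\<exists>A B h1 h2. hyperbolic_sector F p A h1 \<and> hyperbolic_sector F p B h2 \<and>
       (\<exists>U. openin (top_of_set S2) U \<and> p \<in> U \<and> U \<subseteq> A \<union> B) \<and>
       h1 ` ({0} \<times> {0..1}) = h2 ` ({0} \<times> {0..1}) \<and>
       h1 ` ({0..1} \<times> {0}) = h2 ` ({0..1} \<times> {0}) \<and>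
       A \<inter> B = h1 ` ({0} \<times> {0..1}) \<union> h1 ` ({0..1} \<times> {0}))"

end

theory Submission
  imports Defs "HOL-Complex_Analysis.Great_Picard" "HOL-Real_Asymp.Real_Asymp"
begin

text \<open>
  Let \<open>\<theta>\<close> be the longitude and \<open>v\<close> the cotangent of the colatitude, so that \<open>v = z3 / sqrt (z1\<^sup>2 + z2\<^sup>2)\<close>.
  Then \<open>w = v\<^sup>3\<close> as a function of \<open>\<theta>\<close> satisfies \<open>w' = - 3 (C + B v\<^sup>2)\<close>, where \<open>B = b1 cos \<theta> + b2 sin \<theta>\<close> and
  \<open>C\<close> is the cubic part of the field; the equator is \<open>w = 0\<close>, and its critical points are the zeros of
  \<open>C\<close>.  As \<open>B\<close> and \<open>C\<close> change sign under \<open>\<theta> \<mapsto> \<theta> + \<pi>\<close>, an intermediate value argument for Euler polygons and a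
  compactness argument give a solution with \<open>w (\<theta> + \<pi>) = - w \<theta>\<close>.

  If this curve passes through a critical point of the equator, it also passes through the antipodal
  one, and the arc up to the next critical point is a heteroclinic connection, since the time needed to
  reach a critical point is infinite.  Otherwise the curve, parametrized by time, is a symmetric
  periodic solution.  All its crossings of an arc between two zeros of \<open>C\<close> go in the same direction, so
  crossings alternate with zeros of \<open>C\<close>; hence their number in a half turn is at most three, and it is odd
  by antisymmetry.
\<close>

section \<open>Antiperiodic solutions of a scalar equation\<close>

lemma signed_primitive:
  fixes f :: "real \<Rightarrow> real"
  assumes J: "is_interval J" and int: "\<And>a b. a \<in> J \<Longrightarrow> b \<in> J \<Longrightarrow> f integrable_on {a..b}"
  obtains T where "\<And>a b. a \<in> J \<Longrightarrow> b \<in> J \<Longrightarrow> a \<le> b \<Longrightarrow> (f has_integral (T b - T a)) {a..b}"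
proof (cases "J = {}")
  case False
  then obtain m where m: "m \<in> J" by blast
  \<comment> \<open>For \<open>x < m\<close> the interval \<open>{m..x}\<close> is empty, for
    \<open>x > m\<close> the other one is; so this difference is the oriented integral from the base
    point \<open>m\<close>.\<close>
  define T where "T x = integral {m..x} f - integral {x..m} f" for x
  have empty: "integral {v..u} f = 0" if "u \<le> v" for u v :: real
    using that by (cases "u = v") auto
  have "(f has_integral (T b - T a)) {a..b}" if ab: "a \<in> J" "b \<in> J" "a \<le> b" for a b
  proof -
    have split: "integral {u..v} f + integral {v..w} f = integral {u..w} f"
      if "u \<le> v" "v \<le> w" "u \<in> J" "w \<in> J" for u v w
      using that int by (intro Henstock_Kurzweil_Integration.integral_combine) auto
    have "T b - T a = integral {a..b} f"
    proof -
      consider "m \<le> a" | "a \<le> m" "m \<le> b" | "b \<le> m" by linarith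
      then show ?thesis
      proof cases
        case 1 with split[of m a b] empty[of m a] empty[of m b] ab m show ?thesis by (simp add: T_def)
      next
        case 2 with split[of a m b] empty[of a m] empty[of b m] ab m show ?thesis
          by (simp add: T_def empty)
      next
        case 3 with split[of a b m] empty[of a m] empty[of b m] ab m show ?thesis by (simp add: T_def)
      qed
    qed
    then show ?thesis using int[OF ab(1,2)] by (simp add: integrable_integral)
  qed
  then show ?thesis using that by blast
qed (use that in blast)

text \<open>Near \<open>x\<close> the primitive differs by a constant from the indefinite integral
  that starts a little to the left of \<open>x\<close>. Continuity of \<open>f\<close> is asked at
  \<open>x\<close> alone because the lemma is later applied to \<open>slowness\<close>, which may
  have poles elsewhere.\<close>

lemma primitive_has_vector_derivative:
  fixes f T :: "real \<Rightarrow> 'a::banach"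
  assumes "open J" "x \<in> J" "isCont f x"
    and T: "\<And>a b. a \<in> J \<Longrightarrow> b \<in> J \<Longrightarrow> a \<le> b \<Longrightarrow> (f has_integral (T b - T a)) {a..b}"
  shows "(T has_vector_derivative f x) (at x)"
proof -
  obtain e where e: "e > 0" "cball x e \<subseteq> J"
    using assms(1,2) open_contains_cball by blast
  define a b where "a = x - e" and "b = x + e"
  have ab: "a < x" "x < b" "{a..b} \<subseteq> J"
    using e by (auto simp: a_def b_def cball_eq_atLeastAtMost)
  have int: "f integrable_on {a..b}" using T[of a b] ab by (auto simp: subset_iff)
  have "((\<lambda>u. integral {a..u} f) has_vector_derivative f x) (at x within ({a..b} - {}))"
    using int ab assms(3)
    by (intro integral_has_vector_derivative_continuous_at)
       (auto intro: continuous_at_imp_continuous_at_within)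
  moreover have "at x within {a..b} = at x"
    using ab by (intro at_within_interior) (auto simp: interior_atLeastAtMost_real)
  ultimately have 1: "((\<lambda>u. T a + integral {a..u} f) has_vector_derivative f x) (at x)"
    by (auto intro!: derivative_eq_intros)
  show ?thesis
  proof (rule has_vector_derivative_transform_within_open[OF 1, of "{a<..<b}"])
    fix y assume "y \<in> {a<..<b}"
    then have "(f has_integral (T y - T a)) {a..y}" using ab by (intro T) auto
    then show "T a + integral {a..y} f = T y" by (simp add: integral_unique)
  qed (use ab in auto)
qed

text \<open>As \<open>x\<close> is continuous, the fundamental theorem with finitely many exceptions
  makes it a primitive of \<open>g\<close>; continuity of \<open>g\<close> then gives the derivative
  at the exceptional times as well.\<close>

lemma has_vector_derivative_at_exceptional_points:
  fixes x g :: "real \<Rightarrow> 'a::banach"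
  assumes contx: "continuous_on UNIV x" and contg: "continuous_on UNIV g"
    and fin: "\<And>a b. finite {t \<in> {a..b}. P t}"
    and der: "\<And>t. \<not> P t \<Longrightarrow> (x has_vector_derivative g t) (at t)"
  shows "(x has_vector_derivative g t) (at t)"
proof (rule primitive_has_vector_derivative[of UNIV])
  show "isCont g t" using contg by (simp add: continuous_on_eq_continuous_at)
  show "(g has_integral (x b - x a)) {a..b}" if "a \<le> b" for a b
    by (rule fundamental_theorem_of_calculus_strong[OF fin[of a b] that])
       (auto intro: der continuous_on_subset[OF contx])
qed auto

section \<open>Antiperiodic Euler polygons and their limit\<close>

text \<open>Shooting: \<open>N\<close> Euler steps from \<open>y0\<close> move the value by at most
  \<open>p * M\<close>, so \<open>E y0 N + y0\<close> is nonnegative at \<open>y0 = p * M\<close>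
  and nonpositive at \<open>y0 = - (p * M)\<close>. It is continuous in \<open>y0\<close>, and at a
  zero the recursion continues antiperiodically.\<close>

lemma euler_shooting:
  fixes \<Phi> :: "real \<Rightarrow> real \<Rightarrow> real" and N :: nat
  assumes cont: "\<And>t. continuous_on UNIV (\<Phi> t)" and bdd: "\<And>t w. \<bar>\<Phi> t w\<bar> \<le> M"
    and anti: "\<And>t w. \<Phi> (t + p) (- w) = - \<Phi> t w" and "p > 0" "N > 0"
  obtains y :: "int \<Rightarrow> real" where
    "\<And>k. y (k + 1) = y k + p / N * \<Phi> (of_int k * (p / N)) (y k)"
    "\<And>k. y (k + int N) = - y k"
proof -
  define h where "h = p / N"
  have h: "h > 0" "h * N = p" using assms by (auto simp: h_def)
  have M: "M \<ge> 0" using bdd[of 0 0] by linarith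
  define E where "E y0 n = rec_nat y0 (\<lambda>k v. v + h * \<Phi> (real k * h) v) n" for y0 n
  have E0: "E y0 0 = y0" and ES: "E y0 (Suc k) = E y0 k + h * \<Phi> (real k * h) (E y0 k)" for y0 k
    by (auto simp: E_def)
  have contE: "continuous_on UNIV (\<lambda>y0. E y0 k)" for k
  proof (induction k)
    case (Suc k)
    then show ?case unfolding ES
      by (intro continuous_intros continuous_on_compose2[OF cont]) auto
  qed (auto simp: E0 intro: continuous_intros)
  have near: "\<bar>E y0 k - y0\<bar> \<le> k * (h * M)" for y0 k
  proof (induction k)
    case (Suc k)
    have "\<bar>h * \<Phi> (real k * h) (E y0 k)\<bar> \<le> h * M"
      using h bdd by (simp add: abs_mult)
    with Suc show ?case unfolding ES by (simp add: algebra_simps)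
  qed (auto simp: E0)
  have near': "\<bar>E y0 N - y0\<bar> \<le> p * M" for y0
    using near[of y0 N] unfolding h(2)[symmetric] by (simp add: ac_simps)
  have pM: "p * M \<ge> 0" using M assms by simp
  have "\<exists>y0\<ge>- (p * M). y0 \<le> p * M \<and> E y0 N + y0 = 0"
    using near'[of "p * M"] near'[of "- (p * M)"] pM
    by (intro IVT') (auto intro!: continuous_intros continuous_on_subset[OF contE])
  then obtain y0 where y0: "E y0 N = - y0" by (auto simp: eq_neg_iff_add_eq_0)
  define e where "e = E y0"
  have eS: "e (Suc k) = e k + h * \<Phi> (real k * h) (e k)" for k by (simp add: e_def ES)
  have eN: "e (k + N) = - e k" for k
  proof (induction k)
    case (Suc k)
    have "real (k + N) * h = real k * h + p" using h by (simp add: algebra_simps)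
    then show ?case using Suc anti[of "real k * h" "e k"] by (simp add: eS)
  qed (auto simp: e_def y0 E0)
  have e2N: "e (k + 2 * N * m) = e k" for k m
  proof (induction m)
    case (Suc m)
    have eq: "k + 2 * N * Suc m = ((k + 2 * N * m) + N) + N" by simp
    show ?case unfolding eq by (simp only: eN Suc minus_minus)
  qed auto
  have emod: "e (k mod (2 * N)) = e k" for k
    using e2N[of "k mod (2 * N)" "k div (2 * N)"] by simp
  have \<Phi>2: "\<Phi> (t + 2 * p * real m) w = \<Phi> t w" for t w m
  proof (induction m)
    case (Suc m)
    have "\<Phi> ((t + 2 * p * m + p) + p) (- (- w)) = \<Phi> (t + 2 * p * m) w"
      unfolding anti by (rule minus_minus)
    with Suc show ?case by (simp add: algebra_simps)
  qed auto
  have \<Phi>2i: "\<Phi> (t + 2 * p * of_int m) w = \<Phi> t w" for t w m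
  proof (cases "m \<ge> 0")
    case True with \<Phi>2[of t "nat m" w] show ?thesis by simp
  next
    case False with \<Phi>2[of "t + 2 * p * of_int m" "nat (- m)" w] show ?thesis by simp
  qed
  \<comment> \<open>Two half periods bring \<open>e\<close> back to itself, so reduction modulo
    \<open>2 * N\<close> extends the sequence to negative indices.\<close>
  define y where "y k = e (nat (k mod (2 * int N)))" for k
  have yadd: "y (k + int j) = e (nat (k mod (2 * int N)) + j)" for k j
  proof -
    have "nat ((k + int j) mod (2 * int N)) = (nat (k mod (2 * int N)) + j) mod (2 * N)"
      (is "?l = ?r")
    proof -
      have "int ?r = (k mod (2 * int N) + int j) mod (2 * int N)"
        using \<open>N > 0\<close> by (simp add: zmod_int)
      also have "\<dots> = (k + int j) mod (2 * int N)" by (simp add: mod_simps)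
      finally show ?thesis by linarith
    qed
    then show ?thesis unfolding y_def by (simp add: emod)
  qed
  have "y (k + 1) = y k + h * \<Phi> (of_int k * h) (y k)" for k
  proof -
    define j where "j = nat (k mod (2 * int N))"
    have j: "int j = k mod (2 * int N)" using \<open>N > 0\<close> by (simp add: j_def)
    have "k = int j + 2 * int N * (k div (2 * int N))" unfolding j by simp
    then have "real_of_int k = real_of_int (int j + 2 * int N * (k div (2 * int N)))" by (rule arg_cong)
    then have "real_of_int k = real j + 2 * real N * of_int (k div (2 * int N))" by simp
    then have "of_int k * h = (real j + 2 * real N * of_int (k div (2 * int N))) * h" by simp
    also have "\<dots> = real j * h + 2 * p * of_int (k div (2 * int N))"
      unfolding h(2)[symmetric] by (simp add: algebra_simps)
    finally have "\<Phi> (of_int k * h) (y k) = \<Phi> (real j * h) (e j)"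
      by (simp add: \<Phi>2i y_def j_def)
    then show ?thesis using yadd[of k 1] by (simp add: eS j_def[symmetric]) (simp add: y_def j_def)
  qed
  moreover have "y (k + int N) = - y k" for k
    using yadd[of k N] by (simp add: eN y_def)
  ultimately show ?thesis using that unfolding h_def by blast
qed

text \<open>Here \<open>r t\<close> is the last grid point not after \<open>t\<close>, and
  \<open>f\<close> interpolates the values of the recursion. The equation is in integral form
  because \<open>f\<close> has corners and because a limit will be taken under the integral.\<close>

lemma euler_polygon:
  fixes \<Phi> :: "real \<Rightarrow> real \<Rightarrow> real" and N :: nat
  assumes cont: "\<And>t. continuous_on UNIV (\<Phi> t)" and bdd: "\<And>t w. \<bar>\<Phi> t w\<bar> \<le> M"
    and anti: "\<And>t w. \<Phi> (t + p) (- w) = - \<Phi> t w" and "p > 0" "N > 0"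
  defines "r \<equiv> \<lambda>t. of_int \<lfloor>t / (p / N)\<rfloor> * (p / N)"
  obtains f where
    "\<And>a b. a \<le> b \<Longrightarrow> ((\<lambda>t. \<Phi> (r t) (f (r t))) has_integral (f b - f a)) {a..b}"
    "\<And>t. f (t + p) = - f t"
proof -
  define h where "h = p / N"
  have h: "h > 0" "N * h = p" using assms by (auto simp: h_def)
  obtain y where yS: "\<And>k. y (k + 1) = y k + h * \<Phi> (of_int k * h) (y k)"
    and yN: "\<And>k. y (k + int N) = - y k"
    using euler_shooting[where \<Phi> = \<Phi> and p = p and N = N and M = M, OF cont bdd anti assms(4,5)] unfolding h_def by metis
  define G where "G k = \<Phi> (of_int k * h) (y k)" for k
  define g where "g t = G \<lfloor>t / h\<rfloor>" for t
  have bg: "\<bar>g t\<bar> \<le> M" for t by (simp add: g_def G_def bdd)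
  \<comment> \<open>\<open>g\<close> factors through the integers via the floor, and every function
    on a discrete space is measurable.\<close>
  have meas: "g \<in> borel_measurable borel"
    unfolding g_def by (rule measurable_compose[of _ _ "count_space UNIV"]) measurable
  have int: "g integrable_on {a..b}" for a b
  proof (rule measurable_bounded_by_integrable_imp_integrable)
    have "g \<in> borel_measurable lebesgue" using meas by (intro measurable_completion) simp
    then show "g \<in> borel_measurable (lebesgue_on {a..b})" by (rule measurable_restrict_space1)
    show "(\<lambda>_. M) integrable_on {a..b}" by (rule integrable_const_ivl)
  qed (use bg in auto)
  obtain T where T: "\<And>a b. a \<le> b \<Longrightarrow> (g has_integral (T b - T a)) {a..b}"
    using signed_primitive[of UNIV g] int by auto
  define f where "f t = T t - T 0 + y 0" for t
  have f: "(g has_integral (f b - f a)) {a..b}" if "a \<le> b" for a b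
    using T[OF that] by (simp add: f_def)
  have step: "f (of_int (k + 1) * h) - f (of_int k * h) = h * G k" for k
  proof -
    have "((\<lambda>t. G k) has_integral (h * G k)) {of_int k * h..of_int (k + 1) * h}"
      using has_integral_const_real[of "G k" "of_int k * h" "of_int (k + 1) * h"] h
      by (simp add: algebra_simps)
    then have "(g has_integral (h * G k)) {of_int k * h..of_int (k + 1) * h}"
    proof (rule has_integral_spike_finite[rotated 2])
      show "finite {of_int (k + 1) * h}" by simp
      fix x assume "x \<in> {of_int k * h..of_int (k + 1) * h} - {of_int (k + 1) * h}"
      then have "\<lfloor>x / h\<rfloor> = k" using h
        by (intro floor_unique) (auto simp: field_simps)
      then show "g x = G k" by (simp add: g_def)
    qed
    then show ?thesis using f[of "of_int k * h" "of_int (k + 1) * h"] h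
      by (auto dest: has_integral_unique)
  qed
  have fy: "f (of_int k * h) = y k" for k
  proof (induction k rule: int_induct[of _ 0])
    case base show ?case by (simp add: f_def)
  next
    case (step1 i) then show ?case using step[of i] yS[of i] by (simp add: G_def)
  next
    case (step2 i) then show ?case using step[of "i - 1"] yS[of "i - 1"] by (simp add: G_def)
  qed
  have gr: "g t = \<Phi> (r t) (f (r t))" for t
    by (simp add: g_def G_def fy r_def flip: h_def)
  have ganti: "g (t + p) = - g t" for t
  proof -
    have "(t + p) / h = t / h + of_int (int N)" using h by (simp add: field_simps)
    then have fl: "\<lfloor>(t + p) / h\<rfloor> = \<lfloor>t / h\<rfloor> + int N" by (simp only: floor_add_int)
    have "of_int (\<lfloor>t / h\<rfloor> + int N) * h = of_int \<lfloor>t / h\<rfloor> * h + p" using h by (simp add: algebra_simps)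
    then show ?thesis unfolding g_def fl G_def by (simp only: yN anti)
  qed
  \<comment> \<open>By antiperiodicity of \<open>g\<close>, the increments of \<open>f\<close> over
    \<open>{a + p..b + p}\<close> and \<open>{a..b}\<close> are opposite. So
    \<open>f (t + p) + f t\<close> is constant, and its value at \<open>t = 0\<close> is
    \<open>y (int N) + y 0 = 0\<close>.\<close>
  have const: "f (b + p) + f b = f (a + p) + f a" if "a \<le> b" for a b
  proof -
    have "(g has_integral (f (b + p) - f (a + p))) {a + p..b + p}" using that by (intro f) auto
    then have "((\<lambda>t. g (t + p)) has_integral (f (b + p) - f (a + p))) {a..b}"
      unfolding has_integral_shift_Icc_real[symmetric] by (simp add: o_def add.commute)
    then have "((\<lambda>t. - g t) has_integral (f (b + p) - f (a + p))) {a..b}" by (simp add: ganti)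
    from has_integral_unique[OF this has_integral_neg[OF f[OF that]]] show ?thesis by simp
  qed
  have "f (0 + p) + f 0 = 0"
    using fy[of "int N"] fy[of 0] yN[of 0] h by simp
  then have "f (t + p) = - f t" for t
    using const[of 0 t] const[of t 0] by (cases "t \<ge> 0") auto
  moreover have "((\<lambda>t. \<Phi> (r t) (f (r t))) has_integral (f b - f a)) {a..b}" if "a \<le> b" for a b
    using f[OF that] by (simp add: gr[symmetric])
  ultimately show ?thesis using that by blast
qed

text \<open>The polygons are uniformly bounded and share the Lipschitz constant \<open>M\<close>, so
  a subsequence converges, and dominated convergence carries the integral equation to the limit.
  Compactness replaces a return map since the intended right-hand side need not be Lipschitz in
  \<open>w\<close> at 0.\<close>

lemma antiperiodic_solution_bounded:
  fixes \<Phi> :: "real \<Rightarrow> real \<Rightarrow> real"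
  assumes cont: "continuous_on UNIV (\<lambda>z. \<Phi> (fst z) (snd z))" and bdd: "\<And>t w. \<bar>\<Phi> t w\<bar> \<le> M"
    and anti: "\<And>t w. \<Phi> (t + p) (- w) = - \<Phi> t w" and p: "p > 0"
  obtains w where "\<And>t. (w has_real_derivative \<Phi> t (w t)) (at t)" "\<And>t. w (t + p) = - w t"
    "\<And>t. 2 * \<bar>w t\<bar> \<le> M * p"
proof -
  have M: "M \<ge> 0" using bdd[of 0 0] by linarith
  define r where "r n t = of_int \<lfloor>t / (p / Suc n)\<rfloor> * (p / Suc n)" for n t
  have cont1: "continuous_on UNIV (\<Phi> t)" for t
  proof -
    have "continuous_on UNIV (\<lambda>w. (\<lambda>z. \<Phi> (fst z) (snd z)) (t, w))"
      by (rule continuous_on_compose2[OF cont]) (auto intro: continuous_intros)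
    then show ?thesis by simp
  qed
  have "\<exists>f. (\<forall>a b. a \<le> b \<longrightarrow> ((\<lambda>t. \<Phi> (r n t) (f (r n t))) has_integral (f b - f a)) {a..b}) \<and>
      (\<forall>t. f (t + p) = - f t)" for n
  proof -
    obtain f where "\<And>a b. a \<le> b \<Longrightarrow> ((\<lambda>t. \<Phi> (r n t) (f (r n t))) has_integral (f b - f a)) {a..b}"
        "\<And>t. f (t + p) = - f t"
      using euler_polygon[where \<Phi> = \<Phi> and M = M and p = p and N = "Suc n", OF cont1 bdd anti p zero_less_Suc]
      unfolding r_def by blast
    then show ?thesis by blast
  qed
  then obtain f where f: "\<And>n a b. a \<le> b \<Longrightarrow>
      ((\<lambda>t. \<Phi> (r n t) (f n (r n t))) has_integral (f n b - f n a)) {a..b}"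
    and fanti: "\<And>n t. f n (t + p) = - f n t" by metis
  have lip': "\<bar>f n b - f n a\<bar> \<le> M * (b - a)" if "a \<le> b" for n a b
    using has_integral_bound[OF M, of "\<lambda>t. \<Phi> (r n t) (f n (r n t))" "f n b - f n a" a b] f[OF that] bdd that
    by simp
  have lip: "\<bar>f n b - f n a\<bar> \<le> M * \<bar>b - a\<bar>" for n a b
    using lip'[of a b n] lip'[of b a n] by (cases "a \<le> b") (auto simp: abs_minus_commute)
  \<comment> \<open>Over one half period the value changes from \<open>f n t\<close> to
    \<open>- f n t\<close>.\<close>
  have bound: "2 * \<bar>f n t\<bar> \<le> M * p" for n t
    using lip'[of t "t + p" n] p by (simp add: fanti)
  \<comment> \<open>A compact domain of length \<open>2 * p\<close> suffices: all the polygons have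
    period \<open>2 * p\<close>, so convergence there gives convergence everywhere.\<close>
  obtain g k where k: "strict_mono (k :: nat \<Rightarrow> nat)"
    and g: "\<And>e. 0 < e \<Longrightarrow> \<exists>N. \<forall>n x. n \<ge> N \<and> x \<in> {0..2 * p} \<longrightarrow> norm (f (k n) x - g x) < e"
  proof (rule Arzela_Ascoli[of "{0..2 * p}" f "M * p"])
    show "norm (f n x) \<le> M * p" for n x using bound[of n x] by simp
    show "\<exists>d>0. \<forall>n y. y \<in> {0..2 * p} \<and> norm (x - y) < d \<longrightarrow> norm (f n x - f n y) < e"
      if "e > 0" for x e
    proof (intro exI[of _ "e / (M + 1)"] conjI allI impI)
      fix n y assume "y \<in> {0..2 * p} \<and> norm (x - y) < e / (M + 1)"
      then have "\<bar>x - y\<bar> * (M + 1) < e" using M by (simp add: field_simps)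
      moreover have "\<bar>f n x - f n y\<bar> \<le> M * \<bar>x - y\<bar>" by (rule lip)
      ultimately show "norm (f n x - f n y) < e" by (simp add: algebra_simps)
    qed (use that M in auto)
  qed auto
  have f2: "f n (t + 2 * p * real m) = f n t" for n t m
  proof (induction m)
    case (Suc m)
    have "t + 2 * p * real (Suc m) = (t + 2 * p * real m + p) + p" by (simp add: algebra_simps)
    then show ?case using Suc by (simp only: fanti minus_minus)
  qed auto
  have f2i: "f n (t + 2 * p * of_int m) = f n t" for n t m
  proof (cases "m \<ge> 0")
    case True with f2[of n t "nat m"] show ?thesis by simp
  next
    case False with f2[of n "t + 2 * p * of_int m" "nat (- m)"] show ?thesis by simp
  qed
  have "convergent (\<lambda>n. f (k n) t)" for t
  proof -
    define s where "s = t + 2 * p * of_int (- \<lfloor>t / (2 * p)\<rfloor>)"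
    have "s \<in> {0..2 * p}"
      using p floor_divide_lower[of "2 * p" t] floor_divide_upper[of "2 * p" t]
      by (simp add: s_def algebra_simps)
    then have "(\<lambda>n. f (k n) s) \<longlonglongrightarrow> g s" using g unfolding LIMSEQ_iff by meson
    then show ?thesis unfolding s_def f2i by (auto simp: convergent_def)
  qed
  then obtain w where w: "\<And>t. (\<lambda>n. f (k n) t) \<longlonglongrightarrow> w t" unfolding convergent_def by metis
  have wanti: "w (t + p) = - w t" for t
  proof (rule LIMSEQ_unique[OF w])
    show "(\<lambda>n. f (k n) (t + p)) \<longlonglongrightarrow> - w t" unfolding fanti by (intro tendsto_intros w)
  qed
  have wlip: "\<bar>w b - w a\<bar> \<le> M * \<bar>b - a\<bar>" for a b
    by (rule LIMSEQ_le_const2[of "\<lambda>n. \<bar>f (k n) b - f (k n) a\<bar>"]) (auto intro!: tendsto_intros w lip)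
  have contw: "continuous_on UNIV w"
  proof (rule lipschitz_on_continuous_on)
    show "M-lipschitz_on UNIV w"
      using wlip M by (intro lipschitz_onI) (auto simp: dist_real_def)
  qed
  have wbound: "2 * \<bar>w t\<bar> \<le> M * p" for t
    by (rule LIMSEQ_le_const2[of "\<lambda>n. 2 * \<bar>f (k n) t\<bar>"]) (auto intro!: tendsto_intros w bound)
  have rlim: "(\<lambda>n. r (k n) t) \<longlonglongrightarrow> t" for t
  proof (rule LIMSEQ_subseq_LIMSEQ[OF _ k, unfolded o_def])
    have r: "\<bar>r n t - t\<bar> \<le> p / Suc n" for n
    proof -
      define h where "h = p / Suc n"
      have h: "h > 0" using p by (simp add: h_def)
      then show ?thesis
        using floor_divide_lower[of h t] floor_divide_upper[of h t]
        unfolding r_def h_def[symmetric] by (simp add: algebra_simps)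
    qed
    have "(\<lambda>n. p / real (Suc n)) \<longlonglongrightarrow> 0" by real_asymp
    then have "(\<lambda>n. r n t - t) \<longlonglongrightarrow> 0"
      by (rule Lim_null_comparison[rotated]) (use r in auto)
    then show "(\<lambda>n. r n t) \<longlonglongrightarrow> t" by (simp add: LIM_zero_iff)
  qed
  have frlim: "(\<lambda>n. f (k n) (r (k n) t)) \<longlonglongrightarrow> w t" for t
  proof -
    have "(\<lambda>n. M * \<bar>r (k n) t - t\<bar>) \<longlonglongrightarrow> M * \<bar>t - t\<bar>" by (intro tendsto_intros rlim)
    then have lim0: "(\<lambda>n. M * \<bar>r (k n) t - t\<bar>) \<longlonglongrightarrow> 0" by simp
    have "(\<lambda>n. f (k n) (r (k n) t) - f (k n) t) \<longlonglongrightarrow> 0"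
      by (rule Lim_null_comparison[OF _ lim0]) (simp add: lip)
    from tendsto_add[OF this w[of t]] show ?thesis by simp
  qed
  have \<Phi>lim: "(\<lambda>n. \<Phi> (r (k n) t) (f (k n) (r (k n) t))) \<longlonglongrightarrow> \<Phi> t (w t)" for t
  proof -
    have "isCont (\<lambda>z. \<Phi> (fst z) (snd z)) (t, w t)" using cont by (simp add: continuous_on_eq_continuous_at)
    from isCont_tendsto_compose[OF this tendsto_Pair[OF rlim frlim]] show ?thesis by simp
  qed
  have "(w has_vector_derivative \<Phi> t (w t)) (at t)" for t
  proof (rule primitive_has_vector_derivative[of UNIV])
    have "continuous_on UNIV (\<lambda>t. (\<lambda>z. \<Phi> (fst z) (snd z)) (t, w t))"
      by (rule continuous_on_compose2[OF cont]) (auto intro!: continuous_intros contw)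
    then show "isCont (\<lambda>t. \<Phi> t (w t)) t" by (simp add: continuous_on_eq_continuous_at)
    fix a b :: real assume ab: "a \<le> b"
    show "((\<lambda>t. \<Phi> t (w t)) has_integral (w b - w a)) {a..b}"
      by (rule has_integral_dominated_convergence[OF f[OF ab], where h = "\<lambda>_. M"])
         (use bdd \<Phi>lim in \<open>auto intro!: tendsto_intros w\<close>)
  qed auto
  then have "(w has_real_derivative \<Phi> t (w t)) (at t)" for t
    by (simp add: has_real_derivative_iff_has_vector_derivative)
  then show ?thesis using that wanti wbound by blast
qed

text \<open>
  The right-hand side is truncated at \<open>\<bar>w\<bar> = R\<close>.  It grows only like \<open>\<bar>w\<bar>\<close> to the power
  \<open>2/3\<close>, so for large \<open>R\<close> an antiperiodic solution never reaches the truncation.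
\<close>
lemma antiperiodic_solution:
  fixes b c :: "real \<Rightarrow> real"
  assumes cont: "continuous_on UNIV b" "continuous_on UNIV c"
    and bdd: "\<And>t. \<bar>b t\<bar> \<le> B" "\<And>t. \<bar>c t\<bar> \<le> A"
    and anti: "\<And>t. b (t + p) = - b t" "\<And>t. c (t + p) = - c t" and p: "p > 0"
  obtains w where "\<And>t. (w has_real_derivative - 3 * (c t + b t * (root 3 (w t))\<^sup>2)) (at t)"
    "\<And>t. w (t + p) = - w t"
proof -
  have AB: "A \<ge> 0" "B \<ge> 0" using bdd[of 0] by linarith+
  \<comment> \<open>\<open>r\<close> bounds the cube root, so the truncation level is
    \<open>r ^ 3\<close>. The two lower bounds on \<open>r\<close> serve the chain
    \<open>M * p <= 3 * p * (A + B) * r^2 <= r ^ 3\<close>, which keeps the solution within that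
    level.\<close>
  define r where "r = max 1 (3 * p * (A + B))"
  have r: "r \<ge> 1" "3 * p * (A + B) \<le> r" by (auto simp: r_def)
  define trunc where "trunc w = max (- (r ^ 3)) (min (r ^ 3) w)" for w
  define \<Phi> where "\<Phi> t w = - 3 * (c t + b t * (root 3 (trunc w))\<^sup>2)" for t w
  define M where "M = 3 * (A + B * r\<^sup>2)"
  have r3: "r ^ 3 > 0" using r by simp
  have "trunc (- w) = - trunc w" for w using r3 unfolding trunc_def max_def min_def by argo
  then have anti\<Phi>: "\<Phi> (t + p) (- w) = - \<Phi> t w" for t w
    by (simp add: \<Phi>_def anti real_root_minus)
  have trunc_eq: "trunc w = w" if "\<bar>w\<bar> \<le> r ^ 3" for w using that unfolding trunc_def by linarith
  have root: "(root 3 (trunc w))\<^sup>2 \<le> r\<^sup>2" for w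
  proof -
    have "\<bar>trunc w\<bar> \<le> r ^ 3" using r3 unfolding trunc_def by linarith
    then have "root 3 \<bar>trunc w\<bar> \<le> root 3 (r ^ 3)" by (rule real_root_le_mono[rotated]) simp
    then have "\<bar>root 3 (trunc w)\<bar> \<le> r" using r by (simp add: real_root_abs real_root_power_cancel)
    then show ?thesis using r by (simp add: abs_le_square_iff[symmetric])
  qed
  have bdd\<Phi>: "\<bar>\<Phi> t w\<bar> \<le> M" for t w
  proof -
    have "\<bar>b t * (root 3 (trunc w))\<^sup>2\<bar> \<le> B * r\<^sup>2"
      using mult_mono[OF bdd(1)[of t] root] AB by (simp add: abs_mult)
    then show ?thesis using bdd(2)[of t] unfolding \<Phi>_def M_def by (simp add: abs_if split: if_splits)
  qed
  have cont\<Phi>: "continuous_on UNIV (\<lambda>z. \<Phi> (fst z) (snd z))"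
    unfolding \<Phi>_def trunc_def
    by (intro continuous_intros continuous_on_compose2[OF cont(1)] continuous_on_compose2[OF cont(2)]) auto
  obtain w where w: "\<And>t. (w has_real_derivative \<Phi> t (w t)) (at t)" "\<And>t. w (t + p) = - w t"
    and wM: "\<And>t. 2 * \<bar>w t\<bar> \<le> M * p"
    using antiperiodic_solution_bounded[where \<Phi> = \<Phi> and M = M and p = p, OF cont\<Phi> bdd\<Phi> anti\<Phi> p] by metis
  have "M * p \<le> 3 * (A * r\<^sup>2 + B * r\<^sup>2) * p"
    unfolding M_def using AB r p by (intro mult_right_mono mult_left_mono add_mono) (auto simp: mult_le_cancel_left1)
  also have "\<dots> = (3 * p * (A + B)) * r\<^sup>2" by (simp add: algebra_simps)
  also have "\<dots> \<le> r * r\<^sup>2" using r by (intro mult_right_mono) auto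
  finally have "\<bar>w t\<bar> \<le> r ^ 3" for t using wM[of t] r3 by (simp add: power3_eq_cube power2_eq_square mult.assoc)
  then have "trunc (w t) = w t" for t using trunc_eq by blast
  then have "(w has_real_derivative - 3 * (c t + b t * (root 3 (w t))\<^sup>2)) (at t)" for t
    using w(1)[of t] by (simp only: \<Phi>_def)
  then show ?thesis using that w(2) by blast
qed

section \<open>The time parametrization\<close>

text \<open>The derivative \<open>c'\<close> enters twice: through the integration by parts at
  regular zeros, where \<open>v / c\<close> is differentiated, and through the linear bound on
  \<open>c\<close> at singular zeros.\<close>

locale radial_equation =
  fixes b c c' w :: "real \<Rightarrow> real"
  assumes cont_b: "continuous_on UNIV b" and cont_c': "continuous_on UNIV c'"
    and c_deriv: "\<And>t. (c has_real_derivative c' t) (at t)"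
    and w_deriv: "\<And>t. (w has_real_derivative - 3 * (c t + b t * (root 3 (w t))\<^sup>2)) (at t)"
begin

definition v :: "real \<Rightarrow> real" where "v t = root 3 (w t)"

text \<open>What is excluded is a meeting with the equator at one of its critical points.\<close>

definition regular :: "real \<Rightarrow> bool" where "regular t \<longleftrightarrow> (w t = 0 \<longrightarrow> c t \<noteq> 0)"

text \<open>
  The rate \<open>dt/d\<theta>\<close> at which time passes along the curve; its value at the zeros of \<open>v\<close>
  is junk, but these will be negligible.
\<close>
definition slowness :: "real \<Rightarrow> real" where "slowness t = 1 + 1 / (v t)\<^sup>2"

lemma v_eq_0_iff [simp]: "v t = 0 \<longleftrightarrow> w t = 0"
  by (simp add: v_def)

lemma v_cubed: "v t ^ 3 = w t"
  by (simp add: v_def odd_real_root_pow)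

lemma slowness_ge_1: "slowness t \<ge> 1"
  by (simp add: slowness_def)

lemma cont_w: "continuous_on S w"
  using w_deriv by (meson DERIV_isCont continuous_at_imp_continuous_on)

lemma cont_v: "continuous_on S v"
  unfolding v_def by (intro continuous_intros cont_w)

lemma cont_c: "continuous_on S c"
  using c_deriv by (meson DERIV_isCont continuous_at_imp_continuous_on)

lemma v_deriv:
  assumes "w t \<noteq> 0"
  shows "(v has_real_derivative - (b t + c t / (v t)\<^sup>2)) (at t)"
proof -
  have r: "root 3 (w t) \<noteq> 0" using assms by simp
  have "((\<lambda>t. root 3 (w t)) has_real_derivative
      inverse (3 * root 3 (w t) ^ 2) * (- 3 * (c t + b t * (root 3 (w t))\<^sup>2))) (at t)"
  proof (rule DERIV_chain2[OF _ w_deriv])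
    show "(root 3 has_real_derivative inverse (3 * (root 3 (w t))\<^sup>2)) (at (w t))"
      using DERIV_odd_real_root[of 3 "w t"] assms by simp
  qed
  also have "inverse (3 * root 3 (w t) ^ 2) * (- 3 * (c t + b t * (root 3 (w t))\<^sup>2)) = - (b t + c t / (v t)\<^sup>2)"
    using r by (simp add: v_def field_simps)
  finally show ?thesis by (simp add: v_def[abs_def])
qed

lemma isCont_slowness: "w t \<noteq> 0 \<Longrightarrow> isCont slowness t"
  unfolding slowness_def
  using cont_v[of UNIV] by (auto intro!: continuous_intros simp: continuous_on_eq_continuous_at)

text \<open>The equation gives \<open>w\<close> the slope \<open>- 3 * c u\<close> at
  \<open>u\<close>: the zero of \<open>w\<close> is simple, although \<open>v\<close> has a vertical
  tangent there.\<close>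

lemma isolated_zero:
  assumes "w u = 0" "c u \<noteq> 0"
  obtains d where "d > 0" "\<And>t. t \<in> ball u d \<Longrightarrow> t \<noteq> u \<Longrightarrow> w t \<noteq> 0"
proof -
  have "((\<lambda>t. (w t - w u) / (t - u)) \<longlongrightarrow> - 3 * c u) (at u)"
    using w_deriv[of u] assms by (simp add: has_field_derivative_iff)
  from tendsto_imp_eventually_ne[OF this, of 0] assms
  have "eventually (\<lambda>t. (w t - w u) / (t - u) \<noteq> 0) (at u)" by simp
  then obtain d where "d > 0" "\<And>t. t \<noteq> u \<Longrightarrow> dist t u < d \<Longrightarrow> (w t - w u) / (t - u) \<noteq> 0"
    unfolding eventually_at by blast
  then show ?thesis using that[of d] assms by (auto simp: dist_commute)
qed

text \<open>An accumulation point of zeros would itself be a zero by continuity, but regular zeros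
  are isolated.\<close>

lemma finite_zeros:
  assumes "\<And>t. t \<in> {p..q} \<Longrightarrow> regular t"
  shows "finite {t \<in> {p..q}. w t = 0}"
proof (rule ccontr)
  define Z where "Z = {t \<in> {p..q}. w t = 0}"
  assume "infinite {t \<in> {p..q}. w t = 0}"
  then obtain u where u: "u \<in> {p..q}" "u islimpt Z"
    using compact_eq_Bolzano_Weierstrass[of "{p..q}"] by (auto simp: Z_def)
  have "closed {t. w t = 0}"
    using cont_w[of UNIV] by (intro closed_Collect_eq) auto
  then have "w u = 0"
    using u(2) islimpt_subset[of u Z "{t. w t = 0}"] by (auto simp: Z_def closed_limpt)
  moreover from this have "c u \<noteq> 0" using assms u by (auto simp: regular_def)
  ultimately obtain d where d: "d > 0" "\<And>t. t \<in> ball u d \<Longrightarrow> t \<noteq> u \<Longrightarrow> w t \<noteq> 0"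
    using isolated_zero by blast
  obtain t where "t \<in> Z" "t \<noteq> u" "dist t u < d" using u(2) d(1) unfolding islimpt_approachable by blast
  with d(2)[of t] show False by (auto simp: Z_def dist_commute)
qed

text \<open>
  Near a zero of \<open>v\<close> the equation \<open>v' = - b - c / v\<^sup>2\<close> is solved for \<open>1 / v\<^sup>2\<close>; an integration
  by parts then gives a continuous primitive.
\<close>
lemma slowness_locally_integrable:
  assumes "regular u"
  shows "\<exists>d>0. \<forall>p q. {p..q} \<subseteq> ball u d \<longrightarrow> slowness integrable_on {p..q}"
proof (cases "w u = 0")
  case False
  have "isCont w u" using cont_w[of UNIV] by (simp add: continuous_on_eq_continuous_at)
  from continuous_at_avoid[OF this False] obtain d where d: "d > 0" "\<And>y. dist u y < d \<Longrightarrow> w y \<noteq> 0" by auto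
  have "slowness integrable_on {p..q}" if "{p..q} \<subseteq> ball u d" for p q
    using that d by (intro integrable_continuous_real continuous_at_imp_continuous_on ballI isCont_slowness) auto
  with d show ?thesis by blast
next
  case True
  then have cu: "c u \<noteq> 0" using assms by (simp add: regular_def)
  obtain d1 where d1: "d1 > 0" "\<And>t. t \<in> ball u d1 \<Longrightarrow> t \<noteq> u \<Longrightarrow> w t \<noteq> 0"
    using isolated_zero[OF True cu] by blast
  have "isCont c u" using cont_c[of UNIV] by (simp add: continuous_on_eq_continuous_at)
  from continuous_at_avoid[OF this cu] obtain d2 where d2: "d2 > 0" "\<And>y. dist u y < d2 \<Longrightarrow> c y \<noteq> 0" by auto
  define d where "d = min d1 d2"
  define J where "J = ball u d"
  \<comment> \<open>Solving \<open>v' = - b - c / v^2\<close> gives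
    \<open>1 / v^2 = - v' / c - b / c\<close>. Since \<open>- v' / c\<close> is the derivative of
    \<open>- v / c\<close> minus \<open>v * c' / c^2\<close>, this is the derivative of
    \<open>- v / c\<close> minus \<open>h\<close>, and \<open>h\<close> is continuous even at
    \<open>u\<close>. Hence the form of \<open>P\<close> below.\<close>
  define h where "h t = b t / c t + v t * c' t / (c t)\<^sup>2" for t
  have d: "d > 0" "\<And>t. t \<in> J \<Longrightarrow> c t \<noteq> 0" "\<And>t. t \<in> J \<Longrightarrow> t \<noteq> u \<Longrightarrow> w t \<noteq> 0"
    using d1 d2 by (auto simp: d_def J_def)
  have J: "open J" "is_interval J" by (auto simp: J_def is_interval_ball_real)
  have cont_h: "continuous_on J h"
  proof -
    have "continuous_on J b" "continuous_on J c'" using cont_b cont_c' continuous_on_subset by blast+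
    moreover have "\<forall>t\<in>J. (c t)\<^sup>2 \<noteq> 0" "\<forall>t\<in>J. c t \<noteq> 0" using d(2) by auto
    ultimately show ?thesis
      unfolding h_def
      by (intro continuous_on_add continuous_on_divide continuous_on_mult continuous_on_power cont_v cont_c)
  qed
  have sub: "{p..q} \<subseteq> J" if "p \<in> J" "q \<in> J" for p q
    using that by (auto intro: mem_is_interval_1_I[OF J(2), of p q])
  have "h integrable_on {p..q}" if "p \<in> J" "q \<in> J" for p q
    using sub[OF that] by (intro integrable_continuous_real continuous_on_subset[OF cont_h])
  then obtain Q where Q: "\<And>a b. a \<in> J \<Longrightarrow> b \<in> J \<Longrightarrow> a \<le> b \<Longrightarrow> (h has_integral (Q b - Q a)) {a..b}"
    using signed_primitive[OF J(2), of h] by blast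
  have Q': "(Q has_real_derivative h t) (at t)" if "t \<in> J" for t
  proof -
    have "isCont h t" using cont_h that J by (simp add: continuous_on_eq_continuous_at)
    from primitive_has_vector_derivative[OF J(1) that this Q] show ?thesis
      by (simp add: has_real_derivative_iff_has_vector_derivative)
  qed
  define P where "P t = t - v t / c t - Q t" for t
  have P': "(P has_real_derivative slowness t) (at t)" if t: "t \<in> J" "t \<noteq> u" for t
  proof -
    have nz: "w t \<noteq> 0" "v t \<noteq> 0" "c t \<noteq> 0" using d(2,3) t by auto
    have "(P has_real_derivative (1 - (- (b t + c t / (v t)\<^sup>2) * c t - v t * c' t) / (c t * c t) - h t)) (at t)"
      unfolding P_def using nz by (intro derivative_intros v_deriv c_deriv Q'[OF t(1)]) auto
    moreover have "1 - (- (b t + c t / (v t)\<^sup>2) * c t - v t * c' t) / (c t * c t) - h t = slowness t"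
      using nz by (simp add: h_def slowness_def field_simps power2_eq_square)
    ultimately show ?thesis by simp
  qed
  have "slowness integrable_on {p..q}" if pq: "{p..q} \<subseteq> ball u d" for p q
  proof (cases "p \<le> q")
    case True
    have pqJ: "{p..q} \<subseteq> J" using pq by (simp add: J_def)
    have "continuous_on J Q" using Q' by (meson DERIV_isCont continuous_at_imp_continuous_on)
    then have "continuous_on {p..q} P"
      unfolding P_def using pqJ d(2)
      by (auto intro!: continuous_on_diff continuous_on_divide continuous_on_id cont_v cont_c
          intro: continuous_on_subset[OF _ pqJ])
    then have "(slowness has_integral (P q - P p)) {p..q}"
      using pqJ P' True
      by (intro fundamental_theorem_of_calculus_strong[of "{u}"])
         (auto simp flip: has_real_derivative_iff_has_vector_derivative)
    then show ?thesis by blast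
  qed auto
  with d(1) show ?thesis by blast
qed

lemma slowness_integrable:
  assumes "\<And>t. t \<in> {p..q} \<Longrightarrow> regular t"
  shows "slowness integrable_on {p..q}"
proof -
  have "\<exists>d>0. \<forall>r s. u \<in> cbox r s \<and> cbox r s \<subseteq> ball u d \<and> cbox r s \<subseteq> cbox p q \<longrightarrow> slowness integrable_on cbox r s"
    if "u \<in> {p..q}" for u
    using slowness_locally_integrable[OF assms[OF that]] by auto
  then show ?thesis using integrable_on_little_subintervals[of p q slowness] by simp
qed


lemma time_exists:
  assumes "is_interval J" "\<And>t. t \<in> J \<Longrightarrow> regular t"
  obtains T where "\<And>p q. p \<in> J \<Longrightarrow> q \<in> J \<Longrightarrow> p \<le> q \<Longrightarrow> (slowness has_integral (T q - T p)) {p..q}"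
proof -
  have "slowness integrable_on {p..q}" if "p \<in> J" "q \<in> J" for p q
    using that assms(2) by (intro slowness_integrable) (auto intro: mem_is_interval_1_I[OF assms(1), of p q])
  then show ?thesis using signed_primitive[OF assms(1), of slowness] that by blast
qed

text \<open>Time passes at least as fast as the longitude. This makes \<open>T\<close> strictly
  increasing and unbounded along complete curves, and its inverse Lipschitz.\<close>

lemma time_increment:
  assumes "(slowness has_integral I) {p..q}" "p \<le> q"
  shows "I \<ge> q - p"
  using has_integral_le[OF has_integral_const_real[of 1 p q] assms(1)] slowness_ge_1 assms(2) by simp

text \<open>
  Where \<open>v = 0\<close> the parametrization is at first only known to be continuous; it is differentiable there
  because the right-hand sides of its equations extend continuously.
\<close>
lemma time_parametrization:
  assumes J: "is_interval J" "open J" and reg: "\<And>t. t \<in> J \<Longrightarrow> regular t"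
    and T: "\<And>p q. p \<in> J \<Longrightarrow> q \<in> J \<Longrightarrow> p \<le> q \<Longrightarrow> (slowness has_integral (T q - T p)) {p..q}"
    and unbdd: "\<And>K. \<exists>t\<in>J. T t \<le> K" "\<And>K. \<exists>t\<in>J. K \<le> T t"
  obtains \<phi> where "\<And>s. \<phi> s \<in> J" "\<And>s. T (\<phi> s) = s" "\<And>t. t \<in> J \<Longrightarrow> \<phi> (T t) = t"
    "strict_mono \<phi>"
    "\<And>s. (\<phi> has_real_derivative (v (\<phi> s))\<^sup>2 / (1 + (v (\<phi> s))\<^sup>2)) (at s)"
    "\<And>s. ((\<lambda>s. v (\<phi> s)) has_real_derivative
        - (c (\<phi> s) + b (\<phi> s) * (v (\<phi> s))\<^sup>2) / (1 + (v (\<phi> s))\<^sup>2)) (at s)"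
proof -
  have sub: "{p..q} \<subseteq> J" if "p \<in> J" "q \<in> J" for p q
    using that by (auto intro: mem_is_interval_1_I[OF J(1), of p q])
  have incr: "q - p \<le> T q - T p" if "p \<in> J" "q \<in> J" "p \<le> q" for p q
    using time_increment[OF T[OF that]] that by simp
  have contT: "continuous_on {p..q} T" if "p \<in> J" "q \<in> J" for p q
  proof (cases "p \<le> q")
    case True
    have "continuous_on {p..q} (\<lambda>x. T p + integral {p..x} slowness)"
      using T[OF that True] by (intro continuous_intros indefinite_integral_continuous_1) auto
    moreover have "T p + integral {p..x} slowness = T x" if "x \<in> {p..q}" for x
      using T[of p x] sub[OF \<open>p \<in> J\<close> \<open>q \<in> J\<close>] that \<open>p \<in> J\<close> by (auto simp: integral_unique subset_iff)
    ultimately show ?thesis by (rule continuous_on_eq)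
  qed auto
  have "\<exists>t\<in>J. T t = s" for s
  proof -
    obtain p q where pq: "p \<in> J" "T p \<le> s" "q \<in> J" "s \<le> T q" using unbdd by meson
    \<comment> \<open>\<open>unbdd\<close> does not order \<open>p\<close> and \<open>q\<close>; the
      monotonicity of \<open>T\<close> does.\<close>
    have "p \<le> q"
    proof (rule ccontr)
      assume "\<not> p \<le> q"
      with incr[of q p] pq show False by auto
    qed
    then obtain t where "p \<le> t" "t \<le> q" "T t = s"
      using IVT'[OF pq(2,4) _ contT[OF pq(1,3)]] by blast
    then show ?thesis using sub[OF pq(1,3)] by auto
  qed
  then obtain \<phi> where \<phi>J: "\<And>s. \<phi> s \<in> J" and T\<phi>: "\<And>s. T (\<phi> s) = s" by metis
  \<comment> \<open>\<open>T\<close> does not shrink distances, so its inverse is nondecreasing and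
    1-Lipschitz, in particular continuous.\<close>
  have lip: "0 \<le> \<phi> s' - \<phi> s \<and> \<phi> s' - \<phi> s \<le> s' - s" if "s \<le> s'" for s s'
  proof -
    have "\<phi> s \<le> \<phi> s'"
    proof (rule ccontr)
      assume "\<not> \<phi> s \<le> \<phi> s'"
      with incr[OF \<phi>J \<phi>J, of s' s] that show False by (simp add: T\<phi>)
    qed
    with incr[OF \<phi>J \<phi>J, of s s'] show ?thesis by (simp add: T\<phi>)
  qed
  have smono: "strict_mono \<phi>"
  proof (rule strict_monoI)
    fix s s' :: real assume "s < s'"
    then have "\<phi> s \<le> \<phi> s'" "\<phi> s \<noteq> \<phi> s'" using lip[of s s'] T\<phi>[of s] T\<phi>[of s'] by auto
    then show "\<phi> s < \<phi> s'" by simp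
  qed
  have \<phi>T: "\<phi> (T t) = t" if "t \<in> J" for t
  proof -
    have "T (\<phi> (T t)) = T t" by (rule T\<phi>)
    with incr[OF that \<phi>J, of "T t"] incr[OF \<phi>J that, of "T t"] show ?thesis
      by (cases "t \<le> \<phi> (T t)") auto
  qed
  have "1-lipschitz_on UNIV \<phi>"
  proof (rule lipschitz_onI)
    show "dist (\<phi> x) (\<phi> y) \<le> 1 * dist x y" for x y
      using lip[of x y] lip[of y x] by (cases "x \<le> y") (auto simp: dist_real_def)
  qed simp
  then have cont\<phi>: "continuous_on UNIV \<phi>" by (rule lipschitz_on_continuous_on)
  have contv\<phi>: "continuous_on UNIV (\<lambda>s. v (\<phi> s))"
    by (rule continuous_on_compose2[OF cont_v[of UNIV] cont\<phi>]) simp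
  have pos: "1 + x\<^sup>2 \<noteq> 0" for x :: real
    using zero_le_power2[of x] by linarith
  \<comment> \<open>The injective map \<open>\<phi>\<close> carries the exceptional times of a
    bounded interval to regular zeros of \<open>w\<close> in a compact one, of which there are
    finitely many.\<close>
  have fin: "finite {s \<in> {p..q}. w (\<phi> s) = 0}" for p q
  proof (rule inj_on_finite)
    show "inj_on \<phi> {s \<in> {p..q}. w (\<phi> s) = 0}"
      using smono by (meson injD inj_onI strict_mono_imp_inj_on)
    show "\<phi> ` {s \<in> {p..q}. w (\<phi> s) = 0} \<subseteq> {t \<in> {\<phi> p..\<phi> q}. w t = 0}"
      using smono by (auto simp: strict_mono_less_eq)
    show "finite {t \<in> {\<phi> p..\<phi> q}. w t = 0}"
      using reg subsetD[OF sub[OF \<phi>J \<phi>J]] by (intro finite_zeros) blast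
  qed
  have \<phi>': "(\<phi> has_real_derivative (v (\<phi> s))\<^sup>2 / (1 + (v (\<phi> s))\<^sup>2)) (at s)" if nz: "w (\<phi> s) \<noteq> 0" for s
  proof -
    have "(T has_vector_derivative slowness (\<phi> s)) (at (\<phi> s))"
      by (rule primitive_has_vector_derivative[OF J(2) \<phi>J isCont_slowness[OF nz] T])
    then have "DERIV T (\<phi> s) :> slowness (\<phi> s)" by (simp add: has_real_derivative_iff_has_vector_derivative)
    then have "DERIV \<phi> s :> inverse (slowness (\<phi> s))"
    proof (rule DERIV_inverse_function)
      show "slowness (\<phi> s) \<noteq> 0" using slowness_ge_1[of "\<phi> s"] by linarith
      show "isCont \<phi> s" using cont\<phi> by (simp add: continuous_on_eq_continuous_at)
      show "s - 1 < s" "s < s + 1" by auto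
    qed (rule T\<phi>)
    also have "inverse (slowness (\<phi> s)) = (v (\<phi> s))\<^sup>2 / (1 + (v (\<phi> s))\<^sup>2)"
      using nz pos by (simp add: slowness_def field_simps)
    finally show ?thesis .
  qed
  have v\<phi>': "((\<lambda>s. v (\<phi> s)) has_real_derivative
      - (c (\<phi> s) + b (\<phi> s) * (v (\<phi> s))\<^sup>2) / (1 + (v (\<phi> s))\<^sup>2)) (at s)" if nz: "w (\<phi> s) \<noteq> 0" for s
  proof -
    have "((\<lambda>s. v (\<phi> s)) has_real_derivative
      - (b (\<phi> s) + c (\<phi> s) / (v (\<phi> s))\<^sup>2) * ((v (\<phi> s))\<^sup>2 / (1 + (v (\<phi> s))\<^sup>2))) (at s)"
      by (rule DERIV_chain2[OF v_deriv[OF nz] \<phi>'[OF nz]])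
    also have "- (b (\<phi> s) + c (\<phi> s) / (v (\<phi> s))\<^sup>2) * ((v (\<phi> s))\<^sup>2 / (1 + (v (\<phi> s))\<^sup>2))
        = - (c (\<phi> s) + b (\<phi> s) * (v (\<phi> s))\<^sup>2) / (1 + (v (\<phi> s))\<^sup>2)"
    proof -
      have "(b (\<phi> s) + c (\<phi> s) / (v (\<phi> s))\<^sup>2) * (v (\<phi> s))\<^sup>2 = c (\<phi> s) + b (\<phi> s) * (v (\<phi> s))\<^sup>2"
        using nz by (simp add: distrib_right)
      then show ?thesis by (simp only: mult_minus_left times_divide_eq_right minus_divide_left)
    qed
    finally show ?thesis .
  qed
  have cb: "continuous_on UNIV (\<lambda>s. b (\<phi> s))" "continuous_on UNIV (\<lambda>s. c (\<phi> s))"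
    using continuous_on_compose2[OF cont_b cont\<phi>] continuous_on_compose2[OF cont_c[of UNIV] cont\<phi>] by auto
  have 1: "(\<phi> has_real_derivative (v (\<phi> s))\<^sup>2 / (1 + (v (\<phi> s))\<^sup>2)) (at s)" for s
    unfolding has_real_derivative_iff_has_vector_derivative
    by (rule has_vector_derivative_at_exceptional_points[where P = "\<lambda>s. w (\<phi> s) = 0"])
       (use \<phi>' fin pos in \<open>auto intro!: continuous_intros contv\<phi> cont\<phi>
          simp: has_real_derivative_iff_has_vector_derivative\<close>)
  have 2: "((\<lambda>s. v (\<phi> s)) has_real_derivative
      - (c (\<phi> s) + b (\<phi> s) * (v (\<phi> s))\<^sup>2) / (1 + (v (\<phi> s))\<^sup>2)) (at s)" for s
    unfolding has_real_derivative_iff_has_vector_derivative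
    by (rule has_vector_derivative_at_exceptional_points[where P = "\<lambda>s. w (\<phi> s) = 0"])
       (use v\<phi>' fin pos in \<open>auto intro!: continuous_intros contv\<phi> cb
          simp: has_real_derivative_iff_has_vector_derivative\<close>)
  show ?thesis using that[OF \<phi>J T\<phi> \<phi>T smono 1 2] by blast
qed

section \<open>Infinite time at singular zeros\<close>

text \<open>
  A bootstrap: with \<open>a\<^sup>3 = \<bar>t - u\<bar>\<close>, the estimate \<open>w = O(a\<^sup>3)\<close> gives \<open>v = O(a)\<close>, hence \<open>w' = O(a\<^sup>2)\<close> and
  \<open>w = O(a\<^sup>5)\<close>, which is more than needed.
\<close>
lemma v_small_at_singular_zero:
  assumes "w u = 0" "c u = 0"
  obtains L where "L > 0" "\<And>t. \<bar>t - u\<bar> \<le> 1 \<Longrightarrow> (v t)\<^sup>2 \<le> L * \<bar>t - u\<bar>"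
proof -
  define I where "I = {u - 1..u + 1}"
  define w' where "w' t = - 3 * (c t + b t * (v t)\<^sup>2)" for t
  have I: "compact I" "u \<in> I" "convex I" by (auto simp: I_def)
  have w'd: "(w has_real_derivative w' t) (at t within I)" for t
    using w_deriv[of t] has_field_derivative_at_within by (auto simp: w'_def v_def)
  have bound: "\<exists>K\<ge>0. \<forall>t\<in>I. \<bar>f t\<bar> \<le> K" if "continuous_on I f" for f :: "real \<Rightarrow> real"
  proof -
    have "bounded (f ` I)" using compact_imp_bounded compact_continuous_image that I(1) by blast
    then obtain K where "\<And>t. t \<in> I \<Longrightarrow> \<bar>f t\<bar> \<le> K" unfolding bounded_iff by auto
    moreover from this[OF I(2)] have "K \<ge> 0" by linarith
    ultimately show ?thesis by blast
  qed
  have cont_bI: "continuous_on I b" "continuous_on I c'" using cont_b cont_c' continuous_on_subset by blast+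
  obtain B where B: "B \<ge> 0" "\<And>t. t \<in> I \<Longrightarrow> \<bar>b t\<bar> \<le> B" using bound[OF cont_bI(1)] by blast
  obtain C where C: "C \<ge> 0" "\<And>t. t \<in> I \<Longrightarrow> \<bar>c' t\<bar> \<le> C" using bound[OF cont_bI(2)] by blast
  have "continuous_on I w'"
    unfolding w'_def by (intro continuous_intros cont_c cont_v cont_bI)
  then obtain K where K: "K \<ge> 0" "\<And>t. t \<in> I \<Longrightarrow> \<bar>w' t\<bar> \<le> K" using bound by blast
  \<comment> \<open>The crude first round: \<open>c\<close> and \<open>w\<close> vanish at
    \<open>u\<close> and have bounded derivatives on \<open>I\<close>.\<close>
  have c1: "\<bar>c t\<bar> \<le> C * \<bar>t - u\<bar>" if "t \<in> I" for t
    using field_differentiable_bound[OF I(3), of c c' C t u] C that I(2) c_deriv assms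
      has_field_derivative_at_within by force
  have w1: "\<bar>w t\<bar> \<le> K * \<bar>t - u\<bar>" if "t \<in> I" for t
    using field_differentiable_bound[OF I(3), of w w' K t u] K that I(2) w'd assms by force
  define k where "k = root 3 K"
  have k: "k \<ge> 0" "k ^ 3 = K" using K(1) by (auto simp: k_def)
  \<comment> \<open>The factor of \<open>a^2\<close> in the second-round bound on \<open>w'\<close>;
    the summand 1 makes the final constant positive.\<close>
  define M where "M = 3 * (C + B * k\<^sup>2) + 1"
  have M: "M \<ge> 1" using B C by (simp add: M_def)
  have "(v t)\<^sup>2 \<le> root 3 (M\<^sup>2) * \<bar>t - u\<bar>" if t: "\<bar>t - u\<bar> \<le> 1" for t
  proof -
    define a where "a = root 3 \<bar>t - u\<bar>"
    have a: "a \<ge> 0" "a ^ 3 = \<bar>t - u\<bar>" by (auto simp: a_def)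
    have a1: "a \<le> 1" using t real_root_le_mono[of 3 "\<bar>t - u\<bar>" 1] by (simp add: a_def)
    have tI: "t \<in> I" using t by (auto simp: I_def abs_le_iff)
    define S where "S = closed_segment u t"
    have S: "S \<subseteq> I" "convex S" "u \<in> S" "t \<in> S"
      using closed_segment_subset[OF I(2) tI I(3)] by (auto simp: S_def)
    have near: "\<bar>s - u\<bar> \<le> a ^ 3" if "s \<in> S" for s
      using that unfolding S_def a(2) by (auto simp: closed_segment_eq_real_ivl split: if_splits)
    have "\<bar>w' s\<bar> \<le> M * a\<^sup>2" if s: "s \<in> S" for s
    proof -
      have sI: "s \<in> I" using s S by auto
      have "\<bar>v s\<bar> ^ 3 = \<bar>w s\<bar>" by (simp add: power_abs[symmetric] v_cubed)
      also have "\<dots> \<le> K * a ^ 3" using w1[OF sI] mult_left_mono[OF near[OF s] K(1)] by linarith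
      also have "\<dots> = (k * a) ^ 3" using k by (simp add: power_mult_distrib)
      finally have "\<bar>v s\<bar> \<le> k * a" using k a by (meson mult_nonneg_nonneg power_le_imp_le_base
            power_mono_iff[of "\<bar>v s\<bar>" "k * a" 3] abs_ge_zero zero_less_numeral)
      then have "(v s)\<^sup>2 \<le> (k * a)\<^sup>2" using power_mono[of "\<bar>v s\<bar>" "k * a" 2] by simp
      then have "\<bar>b s * (v s)\<^sup>2\<bar> \<le> B * (k * a)\<^sup>2"
        unfolding abs_mult using B sI by (intro mult_mono) auto
      moreover have "\<bar>c s\<bar> \<le> C * a\<^sup>2"
      proof -
        have "a ^ 3 \<le> a\<^sup>2" using a a1 by (intro power_decreasing) auto
        then have "C * \<bar>s - u\<bar> \<le> C * a\<^sup>2" using near[OF s] C by (intro mult_left_mono) auto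
        with c1[OF sI] show ?thesis by linarith
      qed
      ultimately have "\<bar>w' s\<bar> \<le> 3 * (C * a\<^sup>2 + B * (k * a)\<^sup>2)"
        unfolding w'_def by (simp add: abs_if split: if_splits)
      also have "\<dots> \<le> M * a\<^sup>2" by (simp add: M_def algebra_simps power_mult_distrib)
      finally show ?thesis .
    qed
    then have "\<bar>w t - w u\<bar> \<le> M * a\<^sup>2 * \<bar>t - u\<bar>"
      using field_differentiable_bound[OF S(2), of w w' "M * a\<^sup>2" t u] S w'd
      by (metis DERIV_subset real_norm_def)
    then have "\<bar>w t\<bar> \<le> M * a ^ 5"
      using assms by (simp add: a(2)[symmetric] power_add[symmetric] mult.assoc)
    \<comment> \<open>The bound on \<open>v^2\<close> is obtained by comparing cubes, as the cube of
      \<open>v^2\<close> is \<open>w^2\<close>. One power of \<open>a\<close> is given away, using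
      \<open>a <= 1\<close>, so that the right-hand side is a cube too.\<close>
    then have "(w t)\<^sup>2 \<le> (M * a ^ 5)\<^sup>2" using power_mono[of "\<bar>w t\<bar>" "M * a ^ 5" 2] by simp
    also have "\<dots> = M\<^sup>2 * a ^ 10" by (simp add: power_mult_distrib power_mult[symmetric])
    also have "\<dots> \<le> M\<^sup>2 * a ^ 9" using a a1 by (intro mult_left_mono power_decreasing) auto
    also have "\<dots> = (root 3 (M\<^sup>2) * a ^ 3) ^ 3" by (simp add: power_mult_distrib power_mult[symmetric])
    finally have "((v t)\<^sup>2) ^ 3 \<le> (root 3 (M\<^sup>2) * a ^ 3) ^ 3"
      by (simp add: v_cubed[symmetric] power_mult[symmetric])
    then have "(v t)\<^sup>2 \<le> root 3 (M\<^sup>2) * a ^ 3"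
      using a by (subst (asm) power_mono_iff) auto
    then show ?thesis by (simp add: a)
  qed
  moreover have "root 3 (M\<^sup>2) > 0" using M by simp
  ultimately show ?thesis using that by blast
qed

text \<open>Off the zeros of \<open>v\<close>, \<open>slowness t\<close> is at least
  \<open>1 / v^2\<close>, hence at least \<open>1 / (L * \<bar>t - u\<bar>)\<close>, whose integral
  grows like a logarithm as an endpoint approaches \<open>u\<close>.\<close>

lemma time_diverges_at_singular_zero:
  assumes u: "w u = 0" "c u = 0"
  obtains L where "L > 0"
    "\<And>p q I. (\<And>t. t \<in> {p..q} \<Longrightarrow> regular t \<and> t \<noteq> u \<and> \<bar>t - u\<bar> \<le> 1) \<Longrightarrow> p \<le> q \<Longrightarrow>
      (slowness has_integral I) {p..q} \<Longrightarrow> abs (ln (abs (q - u)) - ln (abs (p - u))) \<le> L * I"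
proof -
  obtain L where L: "L > 0" "\<And>t. \<bar>t - u\<bar> \<le> 1 \<Longrightarrow> (v t)\<^sup>2 \<le> L * \<bar>t - u\<bar>"
    using v_small_at_singular_zero[OF u] by blast
  have "abs (ln (abs (q - u)) - ln (abs (p - u))) \<le> L * I"
    if pq: "\<And>t. t \<in> {p..q} \<Longrightarrow> regular t \<and> t \<noteq> u \<and> \<bar>t - u\<bar> \<le> 1" "p \<le> q"
      and I: "(slowness has_integral I) {p..q}" for p q I
  proof -
    define Z where "Z = {t \<in> {p..q}. w t = 0}"
    have Z: "finite Z" unfolding Z_def using pq(1) by (intro finite_zeros) auto
    have "((\<lambda>t. 1 / (t - u)) has_integral (ln (abs (q - u)) - ln (abs (p - u)))) {p..q}"
    proof (rule fundamental_theorem_of_calculus[OF pq(2)])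
      fix t assume "t \<in> {p..q}"
      then have "t - u \<noteq> 0" using pq(1) by auto
      \<comment> \<open>Half the logarithm of the square treats both sides of \<open>u\<close> at
        once.\<close>
      then have "((\<lambda>t. ln ((t - u)\<^sup>2) / 2) has_real_derivative 1 / (t - u)) (at t)"
        by (auto intro!: derivative_eq_intros simp: power2_eq_square zero_less_mult_iff divide_simps)
      moreover have "ln (abs (t - u)) = ln ((t - u)\<^sup>2) / 2" for t
        using ln_realpow[of "\<bar>t - u\<bar>" 2] by (cases "t = u") auto
      ultimately have "((\<lambda>t. ln (abs (t - u))) has_real_derivative 1 / (t - u)) (at t)" by (simp only:)
      then show "((\<lambda>t. ln (abs (t - u))) has_vector_derivative 1 / (t - u)) (at t within {p..q})"
        by (simp add: has_vector_derivative_at_within has_real_derivative_iff_has_vector_derivative)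
    qed
    \<comment> \<open>At the zeros of \<open>v\<close> the junk value of \<open>slowness\<close> is
      too small for the comparison; there are finitely many, so the integrand may be set to 0
      there.\<close>
    then have ln': "((\<lambda>t. if t \<in> Z then 0 else 1 / (t - u)) has_integral (ln (abs (q - u)) - ln (abs (p - u)))) {p..q}"
      by (rule has_integral_spike_finite[OF Z, rotated]) auto
    have LI: "((\<lambda>t. L * slowness t) has_integral L * I) {p..q}"
      by (rule has_integral_mult_right[OF I])
    have "norm (integral {p..q} (\<lambda>t. if t \<in> Z then 0 else 1 / (t - u))) \<le> integral {p..q} (\<lambda>t. L * slowness t)"
    proof -
      have "norm (if t \<in> Z then 0 else 1 / (t - u)) \<le> L * slowness t" if t: "t \<in> {p..q}" for t
      proof (cases "t \<in> Z")
        case True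
        then show ?thesis using L(1) slowness_ge_1[of t] by simp
      next
        case False
        then have pos: "(v t)\<^sup>2 > 0" using t by (simp add: Z_def)
        moreover have "(v t)\<^sup>2 \<le> L * \<bar>t - u\<bar>" "\<bar>t - u\<bar> > 0" using L(2) pq(1)[OF t] by auto
        ultimately have "1 / \<bar>t - u\<bar> \<le> L * (1 / (v t)\<^sup>2)" by (simp add: field_simps)
        also have "\<dots> \<le> L * slowness t" using L(1) by (simp add: slowness_def distrib_left)
        finally show ?thesis using False by (simp add: abs_divide)
      qed
      then show ?thesis
        using has_integral_integrable[OF ln'] has_integral_integrable[OF LI]
        by (intro integral_norm_bound_integral)
    qed
    then show ?thesis by (simp only: integral_unique[OF ln'] integral_unique[OF LI] real_norm_def)
  qed
  then show ?thesis using that L(1) by blast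
qed

lemma time_unbounded_above:
  assumes u: "w u = 0" "c u = 0" and m: "m < u" "u - m \<le> 1" and reg: "\<And>t. t \<in> {m..<u} \<Longrightarrow> regular t"
    and T: "\<And>t. t \<in> {m..<u} \<Longrightarrow> (slowness has_integral (T t - T m)) {m..t}"
  shows "\<exists>t\<in>{m..<u}. K \<le> T t"
proof -
  obtain L where L: "L > 0"
    "\<And>p q I. (\<And>t. t \<in> {p..q} \<Longrightarrow> regular t \<and> t \<noteq> u \<and> \<bar>t - u\<bar> \<le> 1) \<Longrightarrow> p \<le> q \<Longrightarrow>
      (slowness has_integral I) {p..q} \<Longrightarrow> abs (ln (abs (q - u)) - ln (abs (p - u))) \<le> L * I"
    using time_diverges_at_singular_zero[OF u] by metis
  \<comment> \<open>The witness \<open>t\<close> shrinks the distance to \<open>u\<close> by the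
    factor \<open>exp (- D)\<close>, so the logarithms differ by \<open>D\<close>; \<open>D\<close>
    is chosen to force \<open>T\<close> to grow by at least \<open>K - T m\<close>.\<close>
  define D where "D = L * max 0 (K - T m)"
  define t where "t = u - (u - m) * exp (- D)"
  have D: "D \<ge> 0" using L by (simp add: D_def)
  have "(u - m) * exp (- D) > 0" "(u - m) * exp (- D) \<le> (u - m) * 1"
    using m D by (auto intro!: mult_left_mono)
  then have t: "t \<in> {m..<u}" by (auto simp: t_def)
  have "abs (ln (abs (t - u)) - ln (abs (m - u))) \<le> L * (T t - T m)"
    using t m reg by (intro L(2) T) auto
  moreover have "ln (abs (t - u)) - ln (abs (m - u)) = - D"
    using m by (simp add: t_def abs_mult ln_mult)
  ultimately have "L * max 0 (K - T m) \<le> L * (T t - T m)" using D by (simp add: D_def)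
  then have "K - T m \<le> T t - T m" using L(1) by simp
  with t show ?thesis by force
qed

text \<open>The mirror image of \<open>time_unbounded_above\<close>, for curves leaving
  \<open>u\<close> to the right.\<close>

lemma time_unbounded_below:
  assumes u: "w u = 0" "c u = 0" and m: "u < m" "m - u \<le> 1" and reg: "\<And>t. t \<in> {u<..m} \<Longrightarrow> regular t"
    and T: "\<And>t. t \<in> {u<..m} \<Longrightarrow> (slowness has_integral (T m - T t)) {t..m}"
  shows "\<exists>t\<in>{u<..m}. T t \<le> K"
proof -
  obtain L where L: "L > 0"
    "\<And>p q I. (\<And>t. t \<in> {p..q} \<Longrightarrow> regular t \<and> t \<noteq> u \<and> \<bar>t - u\<bar> \<le> 1) \<Longrightarrow> p \<le> q \<Longrightarrow>
      (slowness has_integral I) {p..q} \<Longrightarrow> abs (ln (abs (q - u)) - ln (abs (p - u))) \<le> L * I"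
    using time_diverges_at_singular_zero[OF u] by metis
  define D where "D = L * max 0 (T m - K)"
  define t where "t = u + (m - u) * exp (- D)"
  have D: "D \<ge> 0" using L by (simp add: D_def)
  have "(m - u) * exp (- D) > 0" "(m - u) * exp (- D) \<le> (m - u) * 1"
    using m D by (auto intro!: mult_left_mono)
  then have t: "t \<in> {u<..m}" by (auto simp: t_def)
  have "abs (ln (abs (m - u)) - ln (abs (t - u))) \<le> L * (T m - T t)"
    using t m reg by (intro L(2) T) auto
  moreover have "ln (abs (m - u)) - ln (abs (t - u)) = D"
    using m by (simp add: t_def abs_mult ln_mult)
  ultimately have "L * max 0 (T m - K) \<le> L * (T m - T t)" using D by (simp add: D_def)
  then have "T m - K \<le> T m - T t" using L(1) by simp
  with t show ?thesis by force
qed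

end

section \<open>Curves on the sphere\<close>

lemma vector_3_has_vector_derivative:
  assumes "(f has_real_derivative f') (at t)" "(g has_real_derivative g') (at t)" "(h has_real_derivative h') (at t)"
  shows "((\<lambda>t. vector [f t, g t, h t] :: real^3) has_vector_derivative vector [f', g', h']) (at t)"
proof -
  have eq: "(vector [x, y, z] :: real^3) = x *\<^sub>R axis 1 1 + y *\<^sub>R axis 2 1 + z *\<^sub>R axis 3 1" for x y z :: real
    by (simp add: vec_eq_iff forall_3 axis_def)
  show ?thesis
    unfolding eq using assms
    by (auto intro!: derivative_eq_intros simp: has_real_derivative_iff_has_vector_derivative)
qed

text \<open>These coordinates miss only the poles, which no curve with finite \<open>v\<close>
  reaches.\<close>

definition sphere_point :: "real \<Rightarrow> real \<Rightarrow> real^3" where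
  "sphere_point \<theta> v = vector [cos \<theta> / sqrt (1 + v\<^sup>2), sin \<theta> / sqrt (1 + v\<^sup>2), v / sqrt (1 + v\<^sup>2)]"

lemma one_plus_square_pos: "0 < 1 + x\<^sup>2" for x :: real
  using zero_le_power2[of x] by linarith

lemma sphere_point_in_S2: "sphere_point \<theta> v \<in> S2"
proof -
  have "(cos \<theta>)\<^sup>2 + (sin \<theta>)\<^sup>2 + v\<^sup>2 = 1 + v\<^sup>2" by simp
  then have "(norm (sphere_point \<theta> v))\<^sup>2 = 1"
    unfolding power2_norm_eq_inner
    using one_plus_square_pos[of v]
    by (simp add: sphere_point_def inner_vec_def sum_3 flip: power2_eq_square add_divide_distrib
        add: power_divide)
  then show ?thesis
    using norm_ge_zero[of "sphere_point \<theta> v"] by (auto simp: power2_eq_1_iff simp del: norm_ge_zero)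
qed

text \<open>This is why antiperiodic solutions are sought: for them a half turn is the antipodal
  map.\<close>

lemma sphere_point_add_pi: "sphere_point (\<theta> + pi) (- v) = - sphere_point \<theta> v"
  by (simp add: sphere_point_def vec_eq_iff forall_3)

lemma sphere_point_in_equator_iff: "sphere_point \<theta> v \<in> equator \<longleftrightarrow> v = 0"
  using sphere_point_in_S2[of \<theta> v] one_plus_square_pos[of v] by (auto simp: equator_def) (auto simp: sphere_point_def)

lemma equator_point_eq_iff:
  "sphere_point s 0 = sphere_point t 0 \<longleftrightarrow> (\<exists>n::int. s = t + 2 * pi * n)"
  unfolding sin_cos_eq_iff[symmetric] by (auto simp: sphere_point_def vec_eq_iff forall_3)

lemma sphere_point_periodic: "sphere_point (\<theta> + 2 * pi * of_int n) v = sphere_point \<theta> v"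
proof -
  have "sin (\<theta> + 2 * pi * of_int n) = sin \<theta> \<and> cos (\<theta> + 2 * pi * of_int n) = cos \<theta>"
    unfolding sin_cos_eq_iff by blast
  then show ?thesis by (simp add: sphere_point_def)
qed

lemma tendsto_sphere_point:
  fixes f g :: "real \<Rightarrow> real"
  assumes "(f \<longlongrightarrow> a) F" "(g \<longlongrightarrow> l) F"
  shows "((\<lambda>x. sphere_point (f x) (g x)) \<longlongrightarrow> sphere_point a l) F"
proof (rule vec_tendstoI)
  fix i :: 3
  have "sqrt (1 + l\<^sup>2) \<noteq> 0" using one_plus_square_pos[of l] by simp
  moreover have "((\<lambda>x. cos (f x)) \<longlongrightarrow> cos a) F" "((\<lambda>x. sin (f x)) \<longlongrightarrow> sin a) F"
    using tendsto_cos[OF assms(1)] tendsto_sin[OF assms(1)] .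
  ultimately have "\<forall>i. ((\<lambda>x. sphere_point (f x) (g x) $ i) \<longlongrightarrow> sphere_point a l $ i) F"
    unfolding forall_3 sphere_point_def vector_3 by (intro conjI tendsto_intros assms)
  then show "((\<lambda>x. sphere_point (f x) (g x) $ i) \<longlongrightarrow> sphere_point a l $ i) F" by blast
qed

section \<open>The field in longitude and cotangent coordinates\<close>

definition linear_part :: "real \<Rightarrow> real \<Rightarrow> real \<Rightarrow> real" where
  "linear_part b1 b2 \<theta> = b1 * cos \<theta> + b2 * sin \<theta>"

text \<open>The cubic form of the field on the unit circle, with \<open>z1\<close> factored out:
  what remains is a quadratic form, convenient for counting zeros.\<close>

definition cubic_part :: "real \<Rightarrow> real \<Rightarrow> real \<Rightarrow> real \<Rightarrow> real" where
  "cubic_part a1 a2 a3 \<theta> = cos \<theta> * (a1 * (cos \<theta>)\<^sup>2 + a2 * cos \<theta> * sin \<theta> + a3 * (sin \<theta>)\<^sup>2)"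

text \<open>A single cubic form \<open>g\<close> occurs in all three components: they are
  \<open>z3 * (- z2 * z3 + z1 * g)\<close>, \<open>z3 * (z1 * z3 + z2 * g)\<close> and
  \<open>(z3^2 - 1) * g\<close>. By homogeneity \<open>g\<close> becomes \<open>G / r ^ 3\<close>,
  and \<open>z3^2 - 1\<close> is \<open>- 1 / r^2\<close>.\<close>

lemma vf_sphere_point:
  fixes \<theta> v a1 a2 a3 b1 b2 :: real
  defines "r \<equiv> sqrt (1 + v\<^sup>2)"
  defines "G \<equiv> cubic_part a1 a2 a3 \<theta> + linear_part b1 b2 \<theta> * v\<^sup>2"
  shows "vf a1 a2 a3 b1 b2 (sphere_point \<theta> v) =
    vector [- sin \<theta> * v\<^sup>2 / r ^ 3 + cos \<theta> * v * G / r ^ 5, cos \<theta> * v\<^sup>2 / r ^ 3 + sin \<theta> * v * G / r ^ 5, - G / r ^ 5]"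
proof -
  have r: "r > 0" "v\<^sup>2 = r\<^sup>2 - 1" using one_plus_square_pos[of v] by (auto simp: r_def)
  have sp: "sphere_point \<theta> v = vector [cos \<theta> / r, sin \<theta> / r, v / r]" by (simp add: sphere_point_def r_def)
  have vf_vector: "vf a1 a2 a3 b1 b2 (vector [x, y, z]) = (let g = b1 * x * z\<^sup>2 + b2 * y * z\<^sup>2 + a1 * x ^ 3
      + a2 * x\<^sup>2 * y + a3 * x * y\<^sup>2 in vector [z * (- y * z + x * g), z * (x * z + y * g), (z\<^sup>2 - 1) * g])"
    for x y z
    unfolding vf_def Let_def vector_3
    by (simp add: vec_eq_iff forall_3) (simp add: algebra_simps power2_eq_square power3_eq_cube power4_eq_xxxx)
  have poly: "b1 * (x / r) * (v / r)\<^sup>2 + b2 * (y / r) * (v / r)\<^sup>2 + a1 * (x / r) ^ 3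
      + a2 * (x / r)\<^sup>2 * (y / r) + a3 * (x / r) * (y / r)\<^sup>2
      = (x * (a1 * x\<^sup>2 + a2 * x * y + a3 * y\<^sup>2) + (b1 * x + b2 * y) * v\<^sup>2) / r ^ 3" for x y
    using r(1) by (simp add: field_simps power2_eq_square power3_eq_cube)
  have G: "b1 * (cos \<theta> / r) * (v / r)\<^sup>2 + b2 * (sin \<theta> / r) * (v / r)\<^sup>2 + a1 * (cos \<theta> / r) ^ 3
      + a2 * (cos \<theta> / r)\<^sup>2 * (sin \<theta> / r) + a3 * (cos \<theta> / r) * (sin \<theta> / r)\<^sup>2 = G / r ^ 3" (is "?G = _")
    unfolding poly by (simp add: G_def cubic_part_def linear_part_def)
  have "vf a1 a2 a3 b1 b2 (sphere_point \<theta> v) =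
    vector [v / r * (- (sin \<theta> / r) * (v / r) + cos \<theta> / r * ?G),
      v / r * (cos \<theta> / r * (v / r) + sin \<theta> / r * ?G), ((v / r)\<^sup>2 - 1) * ?G]"
    unfolding sp vf_vector Let_def by simp
  also have "\<dots> = vector [- sin \<theta> * v\<^sup>2 / r ^ 3 + cos \<theta> * v * G / r ^ 5,
      cos \<theta> * v\<^sup>2 / r ^ 3 + sin \<theta> * v * G / r ^ 5, - G / r ^ 5]"
  proof -
    have "(v / r)\<^sup>2 - 1 = - 1 / r\<^sup>2" using r(1) by (simp add: power_divide r(2) diff_divide_distrib)
    then have 3: "((v / r)\<^sup>2 - 1) * (G / r ^ 3) = - G / r ^ 5"
      by (simp add: eval_nat_numeral)
    have 1: "v / r * (- (sin \<theta> / r) * (v / r) + cos \<theta> / r * (G / r ^ 3)) = - sin \<theta> * v\<^sup>2 / r ^ 3 + cos \<theta> * v * G / r ^ 5"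
      using r(1) by (simp add: field_simps eval_nat_numeral)
    have 2: "v / r * (cos \<theta> / r * (v / r) + sin \<theta> / r * (G / r ^ 3)) = cos \<theta> * v\<^sup>2 / r ^ 3 + sin \<theta> * v * G / r ^ 5"
      using r(1) by (simp add: field_simps eval_nat_numeral)
    show ?thesis unfolding G 1 2 3 ..
  qed
  finally show ?thesis .
qed

text \<open>The hypotheses are the field written in the coordinates \<open>\<theta>\<close> and
  \<open>v\<close>. The quotient rule, with \<open>1 + V^2 = r^2\<close>, recovers the Cartesian
  components of \<open>vf_sphere_point\<close>.\<close>

lemma sphere_point_curve_solution:
  assumes \<phi>: "\<And>s. (\<phi> has_real_derivative (V s)\<^sup>2 / (1 + (V s)\<^sup>2)) (at s)"
    and V: "\<And>s. (V has_real_derivative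
      - (cubic_part a1 a2 a3 (\<phi> s) + linear_part b1 b2 (\<phi> s) * (V s)\<^sup>2) / (1 + (V s)\<^sup>2)) (at s)"
  shows "solution (vf a1 a2 a3 b1 b2) (\<lambda>s. sphere_point (\<phi> s) (V s))"
  unfolding solution_def
proof (intro allI conjI)
  fix s
  show "sphere_point (\<phi> s) (V s) \<in> S2" by (rule sphere_point_in_S2)
  define G where "G = cubic_part a1 a2 a3 (\<phi> s) + linear_part b1 b2 (\<phi> s) * (V s)\<^sup>2"
  define r where "r = sqrt (1 + (V s)\<^sup>2)"
  have r: "r > 0" "1 + (V s)\<^sup>2 = r\<^sup>2" using one_plus_square_pos[of "V s"] by (auto simp: r_def)
  note \<phi>' = \<phi>[of s, unfolded r(2)]
  have V': "(V has_real_derivative - G / r\<^sup>2) (at s)" using V[of s] r by (simp add: G_def)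
  have rs: "sqrt (1 + (V s)\<^sup>2) = r" "sqrt (1 + (V s)\<^sup>2) \<noteq> 0" using r(1) by (simp_all add: r_def)
  have "((\<lambda>s. 1 + (V s)\<^sup>2) has_real_derivative 2 * V s * (- G / r\<^sup>2)) (at s)"
    using DERIV_add[OF DERIV_const[of 1] DERIV_power[OF V', of 2]] by (simp add: mult_ac)
  from DERIV_chain2[OF DERIV_real_sqrt[OF one_plus_square_pos] this]
  have r': "((\<lambda>s. sqrt (1 + (V s)\<^sup>2)) has_real_derivative V s * (- G / r\<^sup>2) / r) (at s)"
    unfolding rs(1) by (simp add: field_simps)
  have 1: "((\<lambda>s. cos (\<phi> s) / sqrt (1 + (V s)\<^sup>2)) has_real_derivative
      - sin (\<phi> s) * (V s)\<^sup>2 / r ^ 3 + cos (\<phi> s) * V s * G / r ^ 5) (at s)"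
  proof -
    have "((\<lambda>s. cos (\<phi> s) / sqrt (1 + (V s)\<^sup>2)) has_real_derivative
      (- sin (\<phi> s) * ((V s)\<^sup>2 / r\<^sup>2) * r - cos (\<phi> s) * (V s * (- G / r\<^sup>2) / r)) / (r * r)) (at s)"
      using DERIV_divide[OF DERIV_chain2[OF DERIV_cos \<phi>'] r' rs(2)] unfolding rs(1) .
    also have "(- sin (\<phi> s) * ((V s)\<^sup>2 / r\<^sup>2) * r - cos (\<phi> s) * (V s * (- G / r\<^sup>2) / r)) / (r * r)
        = - sin (\<phi> s) * (V s)\<^sup>2 / r ^ 3 + cos (\<phi> s) * V s * G / r ^ 5"
      using r(1) by (simp add: field_simps eval_nat_numeral)
    finally show ?thesis .
  qed
  have 2: "((\<lambda>s. sin (\<phi> s) / sqrt (1 + (V s)\<^sup>2)) has_real_derivative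
      cos (\<phi> s) * (V s)\<^sup>2 / r ^ 3 + sin (\<phi> s) * V s * G / r ^ 5) (at s)"
  proof -
    have "((\<lambda>s. sin (\<phi> s) / sqrt (1 + (V s)\<^sup>2)) has_real_derivative
      (cos (\<phi> s) * ((V s)\<^sup>2 / r\<^sup>2) * r - sin (\<phi> s) * (V s * (- G / r\<^sup>2) / r)) / (r * r)) (at s)"
      using DERIV_divide[OF DERIV_chain2[OF DERIV_sin \<phi>'] r' rs(2)] unfolding rs(1) .
    also have "(cos (\<phi> s) * ((V s)\<^sup>2 / r\<^sup>2) * r - sin (\<phi> s) * (V s * (- G / r\<^sup>2) / r)) / (r * r)
        = cos (\<phi> s) * (V s)\<^sup>2 / r ^ 3 + sin (\<phi> s) * V s * G / r ^ 5"
      using r(1) by (simp add: field_simps eval_nat_numeral)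
    finally show ?thesis .
  qed
  have 3: "((\<lambda>s. V s / sqrt (1 + (V s)\<^sup>2)) has_real_derivative - G / r ^ 5) (at s)"
  proof -
    have "((\<lambda>s. V s / sqrt (1 + (V s)\<^sup>2)) has_real_derivative
        (- G / r\<^sup>2 * r - V s * (V s * (- G / r\<^sup>2) / r)) / (r * r)) (at s)"
      using DERIV_divide[OF V' r' rs(2)] rs(1) by simp
    also have "(- G / r\<^sup>2 * r - V s * (V s * (- G / r\<^sup>2) / r)) / (r * r) = - G * (r\<^sup>2 - (V s)\<^sup>2) / r ^ 5"
      using r(1) by (simp add: field_simps eval_nat_numeral)
    also have "r\<^sup>2 - (V s)\<^sup>2 = 1" using r(2) by simp
    finally show ?thesis by simp
  qed
  show "((\<lambda>s. sphere_point (\<phi> s) (V s)) has_vector_derivative vf a1 a2 a3 b1 b2 (sphere_point (\<phi> s) (V s))) (at s)"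
    unfolding vf_sphere_point unfolding sphere_point_def
    using vector_3_has_vector_derivative[OF 1 2 3] unfolding r_def G_def .
qed

section \<open>Counting zeros on a half turn\<close>

text \<open>On a set of diameters below pi, \<open>cos\<close> has at most one zero and
  \<open>tan\<close> is injective elsewhere. After division by powers of \<open>cos\<close>, the
  remaining zeros are roots of the nonzero polynomial \<open>a1 + a2 x + a3 x^2\<close> at
  \<open>x = tan t\<close>, at most two.\<close>

lemma cubic_part_zeros:
  assumes "(a1, a2, a3) \<noteq> (0, 0, 0)" and J: "\<And>s t. s \<in> J \<Longrightarrow> t \<in> J \<Longrightarrow> \<bar>s - t\<bar> < pi"
  shows "finite {t \<in> J. cubic_part a1 a2 a3 t = 0}" "card {t \<in> J. cubic_part a1 a2 a3 t = 0} \<le> 3"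
proof -
  define p where "p = [:a1, a2, a3:]"
  have p: "p \<noteq> 0" using assms(1) by (auto simp: p_def)
  define X where "X = {t \<in> J. cos t = 0}"
  define Y where "Y = {t \<in> J. cos t \<noteq> 0 \<and> poly p (tan t) = 0}"
  have eq: "s = t" if st: "s \<in> J" "t \<in> J" "sin (s - t) = 0" for s t
  proof -
    obtain n :: int where n: "s - t = of_int n * pi" using st(3) unfolding sin_zero_iff_int2 by blast
    have "\<bar>of_int n\<bar> * pi < 1 * pi" using J[OF st(1,2)] n by (simp add: abs_mult)
    then have "\<bar>real_of_int n\<bar> < 1" using mult_less_cancel_right_pos[OF pi_gt_zero] by blast
    then have "n = 0" by linarith
    then show ?thesis using n by simp
  qed
  have X: "finite X \<and> card X \<le> 1"
  proof (cases "X = {}")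
    case False
    then obtain x where "x \<in> X" by blast
    moreover have "y = x" if "y \<in> X" for y
    proof (rule eq)
      show "y \<in> J" "x \<in> J" using that \<open>x \<in> X\<close> by (auto simp: X_def)
      have "cos y = 0" "cos x = 0" using that \<open>x \<in> X\<close> by (auto simp: X_def)
      then show "sin (y - x) = 0" by (simp only: sin_diff mult_zero_left mult_zero_right diff_self)
    qed
    ultimately have "X = {x}" by blast
    then show ?thesis by simp
  qed simp
  have inj: "inj_on tan Y"
  proof (rule inj_onI)
    fix s t assume st: "s \<in> Y" "t \<in> Y" "tan s = tan t"
    then have "cos s \<noteq> 0" "cos t \<noteq> 0" by (auto simp: Y_def)
    then have "sin s * cos t = sin t * cos s" using st(3) unfolding tan_def by (simp add: frac_eq_eq)
    then have "sin (s - t) = 0" unfolding sin_diff by (simp add: mult.commute)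
    with st show "s = t" using eq[of s t] unfolding Y_def by blast
  qed
  have sub: "tan ` Y \<subseteq> {x. poly p x = 0}" by (auto simp: Y_def)
  have fr: "finite {x. poly p x = 0}" by (rule poly_roots_finite[OF p])
  have Y: "finite Y" using inj_on_finite[OF inj sub fr] .
  have "card Y \<le> card {x. poly p x = 0}" by (rule card_inj_on_le[OF inj sub fr])
  also have "\<dots> \<le> degree p" by (rule card_poly_roots_bound[OF p])
  also have "\<dots> \<le> 2" by (simp add: p_def)
  finally have cY: "card Y \<le> 2" .
  have subXY: "{t \<in> J. cubic_part a1 a2 a3 t = 0} \<subseteq> X \<union> Y"
  proof
    fix t assume t: "t \<in> {t \<in> J. cubic_part a1 a2 a3 t = 0}"
    show "t \<in> X \<union> Y"
    proof (cases "cos t = 0")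
      case False
      then have "a1 * (cos t)\<^sup>2 + a2 * cos t * sin t + a3 * (sin t)\<^sup>2 = 0" using t by (simp add: cubic_part_def)
      moreover have "(cos t)\<^sup>2 * poly p (tan t) = a1 * (cos t)\<^sup>2 + a2 * cos t * sin t + a3 * (sin t)\<^sup>2"
        using False by (simp add: p_def tan_def field_simps power2_eq_square)
      ultimately show ?thesis using False t by (auto simp: Y_def)
    qed (use t in \<open>auto simp: X_def\<close>)
  qed
  show "finite {t \<in> J. cubic_part a1 a2 a3 t = 0}" using finite_subset[OF subXY] X Y by blast
  have "card {t \<in> J. cubic_part a1 a2 a3 t = 0} \<le> card (X \<union> Y)" using X Y by (intro card_mono subXY) auto
  also have "\<dots> \<le> card X + card Y" by (rule card_Un_le)
  finally show "card {t \<in> J. cubic_part a1 a2 a3 t = 0} \<le> 3" using X cY by linarith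
qed

text \<open>With slopes of one sign, \<open>f\<close> has opposite signs just after \<open>x\<close>
  and just before \<open>y\<close>, so it vanishes in between.\<close>

lemma zero_between_equal_slopes:
  fixes f :: "real \<Rightarrow> real"
  assumes f: "continuous_on {x..y} f" "f x = 0" "f y = 0" "x < y"
    and "(f has_real_derivative k) (at x)" "(f has_real_derivative l) (at y)" "k * l > 0"
  shows "\<exists>z. x < z \<and> z < y \<and> f z = 0"
proof -
  have main: "\<exists>z. x < z \<and> z < y \<and> g z = 0"
    if g: "continuous_on {x..y} g" "g x = 0" "g y = 0"
      "(g has_real_derivative k) (at x)" "(g has_real_derivative l) (at y)" "k > 0" "l > 0" for g k l
  proof -
    obtain d where d: "d > 0" "\<And>h. 0 < h \<Longrightarrow> h < d \<Longrightarrow> g x < g (x + h)"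
      using DERIV_pos_inc_right[OF g(4,6)] by blast
    obtain e where e: "e > 0" "\<And>h. 0 < h \<Longrightarrow> h < e \<Longrightarrow> g (y - h) < g y"
      using DERIV_pos_inc_left[OF g(5,7)] by blast
    \<comment> \<open>A third, rather than a half, keeps \<open>x + h\<close> strictly below
      \<open>y - h\<close>.\<close>
    define h where "h = min (min d e) (y - x) / 3"
    have "0 < h" "3 * h \<le> d" "3 * h \<le> e" "3 * h \<le> y - x" using d e \<open>x < y\<close> by (auto simp: h_def)
    then have h: "0 < h" "h < d" "h < e" "x + h < y - h" by linarith+
    have "\<exists>z\<ge>x + h. z \<le> y - h \<and> g z = 0"
      using d(2)[OF h(1,2)] e(2)[OF h(1,3)] g h
      by (intro IVT2') (auto intro: continuous_on_subset[OF g(1)])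
    then show ?thesis using h(1) by force
  qed
  show ?thesis
  proof (cases "k > 0")
    case True
    then show ?thesis using assms by (intro main[of f k l]) (auto simp: zero_less_mult_iff)
  next
    case False
    then show ?thesis using assms main[of "\<lambda>t. - f t" "- k" "- l"]
      by (auto simp: zero_less_mult_iff intro: continuous_on_minus DERIV_minus)
  qed
qed

section \<open>Zeros, connections and periodic solutions\<close>

context radial_equation begin

text \<open>The slope of \<open>w\<close> at a zero is \<open>- 3 * c\<close>, so the sign of
  \<open>c\<close> is the direction of crossing.\<close>

lemma zero_between_zeros:
  assumes "w x = 0" "w y = 0" "x < y" "c x * c y > 0"
  shows "\<exists>z. x < z \<and> z < y \<and> w z = 0"
proof (rule zero_between_equal_slopes)
  show "(w has_real_derivative - 3 * c x) (at x)" "(w has_real_derivative - 3 * c y) (at y)"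
    using w_deriv[of x] w_deriv[of y] assms by simp_all
  show "- 3 * c x * (- 3 * c y) > 0" using assms by (simp add: algebra_simps)
qed (use assms cont_w in auto)

lemma opposite_signs_at_consecutive_zeros:
  assumes "w x = 0" "w y = 0" "x < y" "regular x" "regular y" "\<And>z. x < z \<Longrightarrow> z < y \<Longrightarrow> w z \<noteq> 0"
  shows "c x * c y < 0" "\<exists>z. x < z \<and> z < y \<and> c z = 0"
proof -
  have nz: "c x \<noteq> 0" "c y \<noteq> 0" using assms by (auto simp: regular_def)
  then show neg: "c x * c y < 0"
    using zero_between_zeros[OF assms(1-3)] assms(6) by (metis mult_eq_0_iff linorder_less_linear)
  have "\<exists>z\<ge>x. z \<le> y \<and> c z = 0"
  proof (cases "c x < 0")
    case True
    with neg have "c y > 0" by (simp add: mult_less_0_iff)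
    with True show ?thesis using assms(3) cont_c by (intro IVT') auto
  next
    case False
    with neg have "c y < 0" by (simp add: mult_less_0_iff)
    with False show ?thesis using assms(3) cont_c by (intro IVT2') auto
  qed
  then show "\<exists>z. x < z \<and> z < y \<and> c z = 0" using nz by (metis order_le_less)
qed

text \<open>
  The signs of \<open>c\<close> at consecutive zeros of \<open>w\<close> alternate, and \<open>c (u + p) = - c u\<close>, so the number
  of zeros in a half-open period is odd; moreover \<open>c\<close> vanishes between any two of them.
\<close>
lemma number_of_zeros:
  assumes reg: "\<And>t. regular t" and u: "w u = 0" "w (u + p) = 0" "c (u + p) = - c u" and p: "p > 0"
    and fin: "finite {t \<in> {u<..<u + p}. c t = 0}" and card: "card {t \<in> {u<..<u + p}. c t = 0} \<le> 3"
  shows "card {t \<in> {u..<u + p}. w t = 0} \<in> {1, 3}"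
proof -
  define Z where "Z = {t \<in> {u..u + p}. w t = 0}"
  define Z' where "Z' = {t \<in> {u..<u + p}. w t = 0}"
  \<comment> \<open>The endpoint \<open>u + p\<close> belongs to \<open>Z\<close>, so every zero in
    the half-open period has a successor.\<close>
  define nxt where "nxt x = Min {z \<in> Z. x < z}" for x
  have Z: "finite Z" unfolding Z_def using reg by (intro finite_zeros) auto
  have Z'Z: "Z' \<subseteq> Z" by (auto simp: Z_def Z'_def)
  have Z': "finite Z'" using finite_subset[OF Z'Z Z] .
  have nxt: "x < nxt x" "nxt x \<in> Z" "\<And>z. z \<in> Z \<Longrightarrow> x < z \<Longrightarrow> nxt x \<le> z" if "x \<in> Z'" for x
  proof -
    have f: "finite {z \<in> Z. x < z}" using Z by auto
    have "u + p \<in> {z \<in> Z. x < z}" using that u p by (auto simp: Z_def Z'_def)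
    then have "{z \<in> Z. x < z} \<noteq> {}" by blast
    from Min_in[OF f this] show "x < nxt x" "nxt x \<in> Z" by (auto simp: nxt_def)
    show "nxt x \<le> z" if "z \<in> Z" "x < z" for z
      unfolding nxt_def using f that by (intro Min_le) auto
  qed
  have consec: "w x = 0 \<and> w (nxt x) = 0 \<and> x < nxt x \<and> (\<forall>z. x < z \<longrightarrow> z < nxt x \<longrightarrow> w z \<noteq> 0)"
    if x: "x \<in> Z'" for x
  proof -
    have "w z \<noteq> 0" if "x < z" "z < nxt x" for z
      using nxt(3)[OF x, of z] nxt(2)[OF x] that x by (fastforce simp: Z_def Z'_def)
    with nxt[OF x] x show ?thesis by (auto simp: Z_def Z'_def)
  qed
  have neg: "c x * c (nxt x) < 0" if "x \<in> Z'" for x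
    using opposite_signs_at_consecutive_zeros(1)[OF _ _ _ reg reg] consec[OF that] by blast
  have "\<exists>z. x < z \<and> z < nxt x \<and> c z = 0" if "x \<in> Z'" for x
    using opposite_signs_at_consecutive_zeros(2)[OF _ _ _ reg reg] consec[OF that] by blast
  then obtain g where g: "\<And>x. x \<in> Z' \<Longrightarrow> x < g x \<and> g x < nxt x \<and> c (g x) = 0" by metis
  have glt: "g x < g y" if "x \<in> Z'" "y \<in> Z'" "x < y" for x y
    using nxt(3)[OF that(1), of y] g[OF that(1)] g[OF that(2)] that Z'Z by force
  have inj: "inj_on g Z'"
    using glt by (metis inj_onI linorder_less_linear order_less_irrefl)
  have img: "g ` Z' \<subseteq> {t \<in> {u<..<u + p}. c t = 0}"
  proof
    fix y assume "y \<in> g ` Z'"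
    then obtain x where x: "x \<in> Z'" "y = g x" by blast
    then have "u \<le> x" "nxt x \<le> u + p" using nxt(2)[OF x(1)] by (auto simp: Z_def Z'_def)
    then show "y \<in> {t \<in> {u<..<u + p}. c t = 0}" using g[OF x(1)] x by auto
  qed
  have le3: "card Z' \<le> 3" using card_inj_on_le[OF inj img fin] card by linarith
  have uZ: "u \<in> Z'" using u p by (auto simp: Z'_def)
  then have ge1: "card Z' \<ge> 1" using Z' by (metis card_0_eq empty_iff less_one linorder_not_less)
  \<comment> \<open>Two sign changes, from \<open>u\<close> over \<open>x\<close> to
    \<open>u + p\<close>, would give \<open>c (u + p)\<close> the sign of \<open>c u\<close>, but it
    is \<open>- c u\<close>.\<close>
  have "card Z' \<noteq> 2"
  proof
    assume "card Z' = 2"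
    then obtain x where x: "Z' = {u, x}" "x \<noteq> u" using uZ by (auto simp: card_2_iff)
    have xZ: "x \<in> Z'" by (simp add: x(1))
    then have ux: "u < x" "x < u + p" using x(2) unfolding Z'_def by auto
    have "Z = Z' \<union> {u + p}" using u p by (auto simp: Z_def Z'_def)
    then have Zx: "z \<in> Z \<longleftrightarrow> z = u \<or> z = x \<or> z = u + p" for z unfolding x(1) by blast
    have "nxt u \<le> x" using nxt(3)[OF uZ] Zx ux by blast
    then have "nxt u = x" using nxt(1,2)[OF uZ] ux unfolding Zx by linarith
    moreover have "nxt x = u + p" using nxt(1,2)[OF xZ] ux unfolding Zx by linarith
    ultimately have "c u * c x < 0" "c x * (- c u) < 0" using neg[OF uZ] neg[OF xZ] u(3) by simp_all
    then show False by (simp add: mult.commute)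
  qed
  with le3 ge1 show ?thesis unfolding Z'_def[symmetric] by auto
qed

end

section \<open>Limit sets of convergent orbits\<close>

lemma omega_limit_singleton:
  assumes "(x \<longlongrightarrow> q) at_top"
  shows "omega_limit x = {q}"
proof -
  have lim: "(\<lambda>n. x (s n)) \<longlonglongrightarrow> q" if "filterlim s at_top sequentially" for s :: "nat \<Rightarrow> real"
    by (rule filterlim_compose[OF assms that])
  then show ?thesis
    unfolding omega_limit_def using LIMSEQ_unique filterlim_real_sequentially by blast
qed

lemma alpha_limit_singleton:
  assumes "(x \<longlongrightarrow> q) at_bot"
  shows "alpha_limit x = {q}"
proof -
  have lim: "(\<lambda>n. x (s n)) \<longlonglongrightarrow> q" if "filterlim s at_bot sequentially" for s :: "nat \<Rightarrow> real"
    by (rule filterlim_compose[OF assms that])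
  moreover have "filterlim (\<lambda>n. - real n) at_bot sequentially"
    using filterlim_real_sequentially by (simp add: filterlim_uminus_at_bot)
  ultimately show ?thesis
    unfolding alpha_limit_def using LIMSEQ_unique by blast
qed

definition cubic_part_deriv :: "real \<Rightarrow> real \<Rightarrow> real \<Rightarrow> real \<Rightarrow> real" where
  "cubic_part_deriv a1 a2 a3 \<theta> =
    - sin \<theta> * (a1 * (cos \<theta>)\<^sup>2 + a2 * cos \<theta> * sin \<theta> + a3 * (sin \<theta>)\<^sup>2) +
    cos \<theta> * (2 * (a3 - a1) * cos \<theta> * sin \<theta> + a2 * ((cos \<theta>)\<^sup>2 - (sin \<theta>)\<^sup>2))"

lemma cubic_part_has_deriv: "(cubic_part a1 a2 a3 has_real_derivative cubic_part_deriv a1 a2 a3 t) (at t)"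
  unfolding cubic_part_def[abs_def] cubic_part_deriv_def
  by (rule derivative_eq_intros refl | simp)+ (simp add: algebra_simps power2_eq_square)

section \<open>The antiperiodic curve: a connection or a periodic orbit\<close>

locale antiperiodic_radial_solution =
  fixes a1 a2 a3 b1 b2 :: real and w :: "real \<Rightarrow> real"
  assumes coeffs: "(a1, a2, a3) \<noteq> (0, 0, 0)"
    and w_ode: "\<And>t. (w has_real_derivative
      - 3 * (cubic_part a1 a2 a3 t + linear_part b1 b2 t * (root 3 (w t))\<^sup>2)) (at t)"
    and w_add_pi: "\<And>t. w (t + pi) = - w t"
begin

sublocale radial_equation "linear_part b1 b2" "cubic_part a1 a2 a3" "cubic_part_deriv a1 a2 a3" w
proof
  show "continuous_on UNIV (linear_part b1 b2)"
    unfolding linear_part_def[abs_def] by (intro continuous_intros)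
  show "continuous_on UNIV (cubic_part_deriv a1 a2 a3)"
    unfolding cubic_part_deriv_def[abs_def] by (intro continuous_intros)
qed (rule cubic_part_has_deriv, rule w_ode)

lemma cubic_part_add_pi: "cubic_part a1 a2 a3 (t + pi) = - cubic_part a1 a2 a3 t"
  by (simp add: cubic_part_def)

lemma v_add_pi: "v (t + pi) = - v t"
  by (simp add: v_def w_add_pi real_root_minus)

lemma w_add_multiple: "w (t + 2 * pi * of_int n) = w t"
proof (induction n rule: int_induct[of _ 0])
  case (step1 i)
  have "t + 2 * pi * of_int (i + 1) = (t + 2 * pi * of_int i + pi) + pi" by (simp add: algebra_simps)
  then show ?case using step1 by (simp only: w_add_pi minus_minus)
next
  case (step2 i)
  have "t + 2 * pi * of_int i = (t + 2 * pi * of_int (i - 1) + pi) + pi" by (simp add: algebra_simps)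
  then show ?case using step2 by (simp only: w_add_pi minus_minus)
qed simp

lemma vf_at_equator: "vf a1 a2 a3 b1 b2 (sphere_point \<theta> 0) = vector [0, 0, - cubic_part a1 a2 a3 \<theta>]"
  by (simp add: vf_sphere_point)

lemma vf_at_equator_eq_0_iff: "vf a1 a2 a3 b1 b2 (sphere_point \<theta> 0) = 0 \<longleftrightarrow> cubic_part a1 a2 a3 \<theta> = 0"
  by (simp add: vf_at_equator vec_eq_iff forall_3)

text \<open>Antiperiodicity makes \<open>u + pi\<close> singular too, so there is a first singular
  point \<open>e\<close> after \<open>u\<close>, at most a half turn away. The arc between them is
  regular and takes infinite time at both ends, so it is a whole orbit joining two critical
  points.\<close>

lemma heteroclinic_connection_exists:
  assumes "\<not> regular u"
  shows "\<exists>x. heteroclinic_connection (vf a1 a2 a3 b1 b2) x"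
proof -
  let ?c = "cubic_part a1 a2 a3"
  have u: "w u = 0" "?c u = 0" using assms by (auto simp: regular_def)
  define A where "A = {t \<in> {u<..u + pi}. w t = 0 \<and> ?c t = 0}"
  have "finite {t \<in> {u<..u + pi}. ?c t = 0}" by (rule cubic_part_zeros(1)[OF coeffs]) auto
  then have A: "finite A" by (rule rev_finite_subset) (auto simp: A_def)
  have "u + pi \<in> A" using u by (simp add: A_def w_add_pi cubic_part_add_pi)
  define e where "e = Min A"
  have "e \<in> A" unfolding e_def using A \<open>u + pi \<in> A\<close> by (intro Min_in) auto
  then have e: "u < e" "e \<le> u + pi" "w e = 0" "?c e = 0" by (auto simp: A_def)
  define J where "J = {u<..<e}"
  have reg: "regular t" if "t \<in> J" for t
  proof (rule ccontr)
    assume "\<not> regular t"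
    then have "t \<in> A" using that e by (auto simp: J_def A_def regular_def)
    then show False using Min_le[OF A, of t] that by (simp add: J_def flip: e_def)
  qed
  have J: "is_interval J" "open J" by (auto simp: J_def is_interval_1)
  obtain T where T: "\<And>p q. p \<in> J \<Longrightarrow> q \<in> J \<Longrightarrow> p \<le> q \<Longrightarrow> (slowness has_integral (T q - T p)) {p..q}"
    using time_exists[OF J(1) reg] by blast
  have above: "\<exists>t\<in>J. K \<le> T t" for K
  proof -
    \<comment> \<open>Within distance 1 of \<open>e\<close>, where the logarithmic estimate holds,
      and still inside \<open>J\<close>.\<close>
    define m where "m = max ((u + e) / 2) (e - 1)"
    have m: "m \<in> J" "m < e" "e - m \<le> 1" "u < m" using e by (auto simp: m_def J_def max_def field_simps)
    have "\<exists>t\<in>{m..<e}. K \<le> T t"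
      using m by (intro time_unbounded_above[OF e(3,4) m(2,3)] reg T) (auto simp: J_def)
    then show ?thesis using m by (auto simp: J_def)
  qed
  have below: "\<exists>t\<in>J. T t \<le> K" for K
  proof -
    define m where "m = min ((u + e) / 2) (u + 1)"
    have m: "m \<in> J" "u < m" "m - u \<le> 1" "m < e" using e by (auto simp: m_def J_def min_def field_simps)
    have "\<exists>t\<in>{u<..m}. T t \<le> K"
      using m by (intro time_unbounded_below[OF u m(2,3)] reg T) (auto simp: J_def)
    then show ?thesis using m by (auto simp: J_def)
  qed
  obtain \<phi> where \<phi>: "\<And>s. \<phi> s \<in> J" "\<And>s. T (\<phi> s) = s" "\<And>t. t \<in> J \<Longrightarrow> \<phi> (T t) = t" "strict_mono \<phi>"
    and \<phi>': "\<And>s. (\<phi> has_real_derivative (v (\<phi> s))\<^sup>2 / (1 + (v (\<phi> s))\<^sup>2)) (at s)"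
    and v\<phi>': "\<And>s. ((\<lambda>s. v (\<phi> s)) has_real_derivative
        - (?c (\<phi> s) + linear_part b1 b2 (\<phi> s) * (v (\<phi> s))\<^sup>2) / (1 + (v (\<phi> s))\<^sup>2)) (at s)"
  proof (rule time_parametrization[OF J _ _ below above])
    show "regular t" if "t \<in> J" for t by (rule reg[OF that])
    show "(slowness has_integral (T q - T p)) {p..q}" if "p \<in> J" "q \<in> J" "p \<le> q" for p q by (rule T[OF that])
  qed (rule that; assumption)
  define x where "x s = sphere_point (\<phi> s) (v (\<phi> s))" for s
  have sol: "solution (vf a1 a2 a3 b1 b2) x"
    unfolding x_def by (rule sphere_point_curve_solution[OF \<phi>' v\<phi>'])
  have \<phi>top: "(\<phi> \<longlongrightarrow> e) at_top"
  proof (rule order_tendstoI)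
    fix a assume "a < e"
    define t where "t = max ((u + e) / 2) ((a + e) / 2)"
    have t: "t \<in> J" "a < t" using \<open>a < e\<close> e by (auto simp: t_def J_def max_def field_simps)
    have "a < \<phi> s" if "s > T t" for s
      using strict_monoD[OF \<phi>(4) that] \<phi>(3)[OF t(1)] t(2) by simp
    then show "\<forall>\<^sub>F s in at_top. a < \<phi> s" by (rule eventually_at_top_dense[THEN iffD2, OF exI, OF allI, OF impI])
  next
    fix a assume "e < a"
    then have "\<phi> s < a" for s using \<phi>(1)[of s] by (simp add: J_def)
    then show "\<forall>\<^sub>F s in at_top. \<phi> s < a" by simp
  qed
  have \<phi>bot: "(\<phi> \<longlongrightarrow> u) at_bot"
  proof (rule order_tendstoI)
    fix a assume "u < a"
    define t where "t = min ((u + e) / 2) ((u + a) / 2)"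
    have t: "t \<in> J" "t < a" using \<open>u < a\<close> e by (auto simp: t_def J_def min_def field_simps)
    have "\<phi> s < a" if "s < T t" for s
      using strict_monoD[OF \<phi>(4) that] \<phi>(3)[OF t(1)] t(2) by simp
    then show "\<forall>\<^sub>F s in at_bot. \<phi> s < a" by (rule eventually_at_bot_dense[THEN iffD2, OF exI, OF allI, OF impI])
  next
    fix a assume "a < u"
    then have "a < \<phi> s" for s using \<phi>(1)[of s] by (simp add: J_def)
    then show "\<forall>\<^sub>F s in at_bot. a < \<phi> s" by simp
  qed
  have isv: "isCont v t" for t using cont_v[of UNIV] by (simp add: continuous_on_eq_continuous_at)
  have xlim: "(x \<longlongrightarrow> sphere_point l 0) F" if "(\<phi> \<longlongrightarrow> l) F" "w l = 0" for l F
  proof -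
    have "v l = 0" using that(2) by simp
    with tendsto_sphere_point[OF that(1) isCont_tendsto_compose[OF isv that(1)]] show ?thesis
      by (simp add: x_def[abs_def])
  qed
  note xtop = xlim[OF \<phi>top e(3)] and xbot = xlim[OF \<phi>bot u(1)]
  \<comment> \<open>As \<open>0 < e - u <= pi\<close>, the longitudes do not differ by a multiple of
    \<open>2 * pi\<close>.\<close>
  have ne: "sphere_point u 0 \<noteq> sphere_point e 0"
  proof
    assume "sphere_point u 0 = sphere_point e 0"
    then obtain n :: int where n: "u = e + 2 * pi * n" unfolding equator_point_eq_iff by blast
    then have "of_int n * (2 * pi) < 0 * (2 * pi)" "(- 1) * (2 * pi) < of_int n * (2 * pi)"
      using e pi_gt_zero by (simp_all add: algebra_simps)
    then have "real_of_int n < 0" "- 1 < real_of_int n"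
      using mult_less_cancel_right_pos[of "2 * pi"] pi_gt_zero by (metis mult_pos_pos zero_less_numeral)+
    then have "n < 0" "of_int (- 1) < real_of_int n" by simp_all
    then show False unfolding of_int_less_iff by linarith
  qed
  have "nonconstant x"
  proof (rule ccontr)
    assume "\<not> nonconstant x"
    then have "x = (\<lambda>_. x 0)" by (auto simp: nonconstant_def)
    with xtop xbot have "((\<lambda>_::real. x 0) \<longlongrightarrow> sphere_point e 0) at_top" "((\<lambda>_::real. x 0) \<longlongrightarrow> sphere_point u 0) at_bot"
      by simp_all
    then have "x 0 = sphere_point e 0" "x 0 = sphere_point u 0"
      by (simp_all add: tendsto_const_iff)
    with ne show False by simp
  qed
  moreover have "sphere_point t 0 \<in> equator \<and> critical_point (vf a1 a2 a3 b1 b2) (sphere_point t 0)"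
    if "?c t = 0" for t
    using that sphere_point_in_S2[of t 0] unfolding critical_point_def sphere_point_in_equator_iff
    by (simp only: vf_at_equator_eq_0_iff simp_thms)
  ultimately have "heteroclinic_connection (vf a1 a2 a3 b1 b2) x"
    unfolding heteroclinic_connection_def
    using sol alpha_limit_singleton[OF xbot] omega_limit_singleton[OF xtop] ne u(2) e(4) by blast
  then show ?thesis by blast
qed

text \<open>\<open>slowness\<close> depends only on \<open>v^2\<close> and so has period pi; each
  half turn therefore takes the same time \<open>P\<close>. A time shift by \<open>P\<close> is then
  the antipodal map on the orbit, and \<open>2 * P\<close> is a period.\<close>

lemma symmetric_periodic_solution_exists:
  assumes reg: "\<And>t. regular t"
  defines "F \<equiv> vf a1 a2 a3 b1 b2"
  shows "\<exists>x. periodic_solution F x \<and> uminus ` range x = range x \<and> card (range x \<inter> equator) \<in> {2, 6} \<and>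
    (\<forall>p \<in> range x \<inter> equator. regular_point F p \<and> - p \<in> range x \<inter> equator)"
proof -
  let ?c = "cubic_part a1 a2 a3"
  obtain T where T: "\<And>p q. p \<le> q \<Longrightarrow> (slowness has_integral (T q - T p)) {p..q}"
    using time_exists[of UNIV] reg by auto
  have above: "\<exists>t\<in>UNIV. K \<le> T t" for K
    using time_increment[OF T[of 0 "max 0 (K - T 0)"]] by (intro bexI[of _ "max 0 (K - T 0)"]) auto
  have below: "\<exists>t\<in>UNIV. T t \<le> K" for K
    using time_increment[OF T[of "min 0 (K - T 0)" 0]] by (intro bexI[of _ "min 0 (K - T 0)"]) auto
  obtain \<phi> where \<phi>: "\<And>s. \<phi> s \<in> UNIV" "\<And>s. T (\<phi> s) = s" "\<And>t. t \<in> UNIV \<Longrightarrow> \<phi> (T t) = t" "strict_mono \<phi>"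
    and \<phi>': "\<And>s. (\<phi> has_real_derivative (v (\<phi> s))\<^sup>2 / (1 + (v (\<phi> s))\<^sup>2)) (at s)"
    and v\<phi>': "\<And>s. ((\<lambda>s. v (\<phi> s)) has_real_derivative
        - (?c (\<phi> s) + linear_part b1 b2 (\<phi> s) * (v (\<phi> s))\<^sup>2) / (1 + (v (\<phi> s))\<^sup>2)) (at s)"
  proof (rule time_parametrization[OF _ _ _ _ below above])
    show "is_interval (UNIV :: real set)" "open (UNIV :: real set)" by auto
    show "regular t" for t by (rule reg)
    show "(slowness has_integral (T q - T p)) {p..q}" if "p \<le> q" for p q by (rule T[OF that])
  qed (rule that; assumption)
  define x where "x s = sphere_point (\<phi> s) (v (\<phi> s))" for s
  have sol: "solution F x"
    unfolding x_def F_def by (rule sphere_point_curve_solution[OF \<phi>' v\<phi>'])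
  have range: "range x = range (\<lambda>t. sphere_point t (v t))"
  proof (intro equalityI image_subsetI)
    show "sphere_point t (v t) \<in> range x" for t
      using \<phi>(3)[of t] by (intro range_eqI[of _ _ "T t"]) (simp add: x_def)
  qed (simp add: x_def)
  have "slowness (t + pi) = slowness t" for t by (simp add: slowness_def v_add_pi)
  then have shift: "T (q + pi) - T (p + pi) = T q - T p" if "p \<le> q" for p q
  proof -
    have "(slowness has_integral (T (q + pi) - T (p + pi))) {p + pi..q + pi}" using that by (intro T) auto
    then have "((\<lambda>t. slowness (t + pi)) has_integral (T (q + pi) - T (p + pi))) {p..q}"
      unfolding has_integral_shift_Icc_real[symmetric] by (simp add: o_def add.commute)
    then show ?thesis using T[OF that] \<open>\<And>t. slowness (t + pi) = slowness t\<close> has_integral_unique by simp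
  qed
  define P where "P = T pi - T 0"
  have P: "P \<ge> pi" using time_increment[OF T[of 0 pi]] by (simp add: P_def)
  then have "P > 0" using pi_gt_zero by linarith
  have Tpi: "T (t + pi) = T t + P" for t
    using shift[of 0 t] shift[of t 0] by (cases "0 \<le> t") (auto simp: P_def)
  have \<phi>P: "\<phi> (s + P) = \<phi> s + pi" for s
    using Tpi[of "\<phi> s"] \<phi>(2)[of s] \<phi>(3)[of "\<phi> s + pi"] by simp
  have xP: "x (s + P) = - x s" for s
    by (simp add: x_def \<phi>P v_add_pi sphere_point_add_pi)
  have period: "x (s + 2 * P) = x s" for s
    using xP[of "s + P"] xP[of s] by (simp add: add.assoc)
  \<comment> \<open>As \<open>x P = - x 0\<close>, equality would put the origin on the
    sphere.\<close>
  have "x 0 \<noteq> x P"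
  proof
    assume "x 0 = x P"
    then have "x 0 = - x 0" using xP[of 0] by simp
    then have "x 0 = 0" by (simp add: vec_eq_iff)
    then show False using sol by (auto simp: solution_def dest: spec[of _ 0])
  qed
  then have "nonconstant x" unfolding nonconstant_def by blast
  then have "periodic_solution F x"
    unfolding periodic_solution_def using sol period \<open>P > 0\<close> by (auto intro!: exI[of _ "2 * P"])
  moreover have sub: "- p \<in> range x" if p: "p \<in> range x" for p
  proof -
    obtain s where "p = x s" using p by blast
    then have "- p = x (s + P)" by (simp add: xP)
    then show ?thesis by blast
  qed
  have "uminus ` range x = range x"
  proof (intro equalityI subsetI)
    fix p assume "p \<in> range x"
    then have "- p \<in> range x" "p = - (- p)" by (simp_all add: sub)
    then show "p \<in> uminus ` range x" by blast
  qed (use sub in blast)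
  moreover have equator_iff: "p \<in> range x \<inter> equator \<longleftrightarrow> (\<exists>t. w t = 0 \<and> p = sphere_point t 0)" for p
  proof
    assume "p \<in> range x \<inter> equator"
    then obtain t where t: "p = sphere_point t (v t)" "p \<in> equator" unfolding range by blast
    then have "v t = 0" by (simp add: sphere_point_in_equator_iff)
    with t show "\<exists>t. w t = 0 \<and> p = sphere_point t 0" by auto
  next
    assume "\<exists>t. w t = 0 \<and> p = sphere_point t 0"
    then obtain t where t: "w t = 0" "p = sphere_point t 0" by blast
    then have "v t = 0" by simp
    have "p = sphere_point t (v t)" unfolding \<open>v t = 0\<close> by (rule t(2))
    then show "p \<in> range x \<inter> equator" using t unfolding range by (auto simp: sphere_point_in_equator_iff)
  qed
  moreover have "regular_point F p \<and> - p \<in> range x \<inter> equator" if p: "p \<in> range x \<inter> equator" for p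
  proof -
    obtain t where t: "w t = 0" "p = sphere_point t 0" using p equator_iff by blast
    then have "?c t \<noteq> 0" using reg[of t] by (simp add: regular_def)
    then have "regular_point F p"
      using sphere_point_in_S2[of t 0]
      unfolding regular_point_def F_def t(2) by (simp add: vf_at_equator_eq_0_iff)
    moreover have "- p \<in> equator" using p by (auto simp: equator_def)
    ultimately show ?thesis using p sub by blast
  qed
  moreover have "card (range x \<inter> equator) \<in> {2, 6}"
  proof -
    \<comment> \<open>\<open>w\<close> changes sign over a half turn; the count has to start at a
      zero of \<open>w\<close>.\<close>
    have "\<exists>u\<ge>0. u \<le> pi \<and> w u = 0"
      using w_add_pi[of 0] cont_w IVT'[of w 0 0 pi] IVT2'[of w pi 0 0] by (cases "w 0 \<le> 0") auto
    then obtain u where u: "w u = 0" by blast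
    define Z where "Z = {t \<in> {u..<u + pi}. w t = 0}"
    \<comment> \<open>The zeros in a full turn are those in a half turn and their translates by pi,
      which doubles the count of 1 or 3.\<close>
    define Z2 where "Z2 = {t \<in> {u..<u + 2 * pi}. w t = 0}"
    have "card Z \<in> {1, 3}" unfolding Z_def
    proof (rule number_of_zeros[OF reg u])
      have "\<bar>s - t\<bar> < pi" if "s \<in> {u<..<u + pi}" "t \<in> {u<..<u + pi}" for s t
        using that by (auto simp: abs_less_iff)
      then show "finite {t \<in> {u<..<u + pi}. ?c t = 0}" "card {t \<in> {u<..<u + pi}. ?c t = 0} \<le> 3"
        using cubic_part_zeros[OF coeffs] by blast+
    qed (use u in \<open>simp_all add: w_add_pi cubic_part_add_pi\<close>)
    moreover have "finite Z" using \<open>card Z \<in> {1, 3}\<close> card.infinite by force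
    moreover have "Z2 = Z \<union> (\<lambda>t. t + pi) ` Z"
    proof (intro equalityI subsetI)
      fix t assume t: "t \<in> Z2"
      show "t \<in> Z \<union> (\<lambda>t. t + pi) ` Z"
      proof (cases "t < u + pi")
        case False
        have "w (t - pi) = 0" using w_add_pi[of "t - pi"] t by (simp add: Z2_def)
        then have "t - pi \<in> Z" using t False by (auto simp: Z_def Z2_def)
        then show ?thesis by (intro UnI2 image_eqI[of _ _ "t - pi"]) auto
      qed (use t in \<open>auto simp: Z_def Z2_def\<close>)
    qed (auto simp: Z_def Z2_def w_add_pi)
    moreover have "Z \<inter> (\<lambda>t. t + pi) ` Z = {}" by (auto simp: Z_def)
    moreover have "card ((\<lambda>t. t + pi) ` Z) = card Z" by (intro card_image) (auto simp: inj_on_def)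
    ultimately have card2: "card Z2 \<in> {2, 6}" by (auto simp: card_Un_disjoint)
    have "inj_on (\<lambda>t. sphere_point t 0) Z2"
    proof (rule inj_onI)
      fix s t assume st: "s \<in> Z2" "t \<in> Z2" "sphere_point s 0 = sphere_point t 0"
      then obtain n :: int where n: "s = t + 2 * pi * n" unfolding equator_point_eq_iff by blast
      have "2 * pi * real_of_int n < 2 * pi * 1" "2 * pi * (- 1) < 2 * pi * real_of_int n"
        using st(1,2) n unfolding Z2_def mem_Collect_eq atLeastLessThan_iff by linarith+
      moreover have "2 * pi > 0" by simp
      ultimately have "real_of_int n < 1" "- 1 < real_of_int n"
        by (blast dest: mult_less_cancel_left_pos[THEN iffD1])+
      then have "n = 0" by linarith
      then show "s = t" using n by simp
    qed
    moreover have "range x \<inter> equator = (\<lambda>t. sphere_point t 0) ` Z2"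
    proof (intro equalityI subsetI)
      fix p assume "p \<in> range x \<inter> equator"
      then obtain t where t: "w t = 0" "p = sphere_point t 0" using equator_iff by blast
      \<comment> \<open>Full turns move the longitude into the half-open interval of
        \<open>Z2\<close> without changing the point or the value of \<open>w\<close>.\<close>
      define n where "n = - \<lfloor>(t - u) / (2 * pi)\<rfloor>"
      define s where "s = t + 2 * pi * of_int n"
      have "s \<in> {u..<u + 2 * pi}"
        using floor_divide_lower[of "2 * pi" "t - u"] floor_divide_upper[of "2 * pi" "t - u"]
        by (simp add: s_def n_def algebra_simps)
      moreover have "p = sphere_point s 0" by (simp add: s_def t sphere_point_periodic)
      moreover have "w s = 0" by (simp add: s_def t w_add_multiple)
      ultimately show "p \<in> (\<lambda>t. sphere_point t 0) ` Z2" by (auto simp: Z2_def)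
    next
      fix p assume "p \<in> (\<lambda>t. sphere_point t 0) ` Z2"
      then show "p \<in> range x \<inter> equator" using equator_iff by (auto simp: Z2_def)
    qed
    ultimately show ?thesis using card2 by (simp add: card_image)
  qed
  ultimately show ?thesis by blast
qed

end

theorem theorem3p10:
  fixes a1 a2 a3 b1 b2 :: real
  assumes "(a1, a2, a3) \<noteq> (0, 0, 0)"
    and "card {p \<in> equator. cusp (vf a1 a2 a3 b1 b2) p} = 6"
    and "\<not> (\<exists>x. homoclinic_connection (vf a1 a2 a3 b1 b2) x)"
    and "\<not> (\<exists>x. heteroclinic_connection (vf a1 a2 a3 b1 b2) x)"
  shows "\<exists>x. periodic_solution (vf a1 a2 a3 b1 b2) x \<and>
           uminus ` range x = range x \<and>
           card (range x \<inter> equator) \<in> {2, 6} \<and>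
           (\<forall>p \<in> range x \<inter> equator.
              regular_point (vf a1 a2 a3 b1 b2) p \<and> - p \<in> range x \<inter> equator)"
proof -
  let ?b = "linear_part b1 b2" and ?c = "cubic_part a1 a2 a3"
  have cont: "continuous_on UNIV ?b" "continuous_on UNIV ?c"
    unfolding linear_part_def[abs_def] cubic_part_def[abs_def] by (intro continuous_intros)+
  have b: "\<bar>?b t\<bar> \<le> \<bar>b1\<bar> + \<bar>b2\<bar>" for t
  proof -
    have "\<bar>b1 * cos t\<bar> \<le> \<bar>b1\<bar>" "\<bar>b2 * sin t\<bar> \<le> \<bar>b2\<bar>"
      by (simp_all add: abs_mult mult_left_le)
    then show ?thesis unfolding linear_part_def by linarith
  qed
  have c: "\<bar>?c t\<bar> \<le> \<bar>a1\<bar> + \<bar>a2\<bar> + \<bar>a3\<bar>" for t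
  proof -
    have 1: "\<bar>y * cos t\<bar> \<le> \<bar>y\<bar>" "\<bar>y * sin t\<bar> \<le> \<bar>y\<bar>" for y
      by (simp_all add: abs_mult mult_left_le)
    have "\<bar>a1 * cos t * cos t * cos t\<bar> \<le> \<bar>a1\<bar>" "\<bar>a2 * cos t * cos t * sin t\<bar> \<le> \<bar>a2\<bar>"
      "\<bar>a3 * sin t * sin t * cos t\<bar> \<le> \<bar>a3\<bar>"
      using 1 order_trans by meson+
    moreover have "?c t = a1 * cos t * cos t * cos t + a2 * cos t * cos t * sin t + a3 * sin t * sin t * cos t"
      by (simp add: cubic_part_def algebra_simps power2_eq_square)
    ultimately show ?thesis by linarith
  qed
  obtain w where w: "\<And>t. (w has_real_derivative - 3 * (?c t + ?b t * (root 3 (w t))\<^sup>2)) (at t)"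
    "\<And>t. w (t + pi) = - w t"
  proof (rule antiperiodic_solution[OF cont b c _ _ pi_gt_zero])
    show "?b (t + pi) = - ?b t" "?c (t + pi) = - ?c t" for t
      by (simp_all add: linear_part_def cubic_part_def)
  qed (rule that; assumption)
  interpret antiperiodic_radial_solution a1 a2 a3 b1 b2 w
    by unfold_locales (use assms(1) w in auto)
  \<comment> \<open>A singular point of the curve would produce a heteroclinic connection.\<close>
  have "regular t" for t
    using heteroclinic_connection_exists assms(4) by blast
  then show ?thesis by (rule symmetric_periodic_solution_exists)
qed

end
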